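(* Let $C$ be the Cesàro operator on $L^2(0,1)$, $(Cf)(x)=\frac1x\int_0^x\frac{f(t)}{1-t}\,dt$ for $0<x<1$. Let $\lambda\in\mathbb{C}$ with $\lambda\notin\partial D(1,1)$ and let $g\in L^2(0,1)$. (a) If $\lambda\in D(1,1)$, then $$((\lambda I-C)^{-1}g)(x)=\frac1\lambda g(x)-\frac{1}{\lambda^2}\,\frac{1}{x^{1-\frac1\lambda}(1-x)^{\frac1\lambda}}\int_x^1 g(t)\,t^{-\frac1\lambda}(1-t)^{-1+\frac1\lambda}\,dt.$$ (b) If $\lambda\notin\overline{D(1,1)}$, then $$((\lambda I-C)^{-1}g)(x)=\frac1\lambda g(x)+\frac{1}{\lambda^2}\,\frac{1}{x^{1-\frac1\lambda}(1-x)^{\frac1\lambda}}\int_0^x g(t)\,t^{-\frac1\lambda}(1-t)^{-1+\frac1\lambda}\,dt.$$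
   Context: $L^2(0,1)$ is the Hilbert space of complex-valued square-integrable functions on $(0,1)$ with respect to Lebesgue measure; $C$ is a bounded linear operator on it with spectrum $\sigma(C)=\partial D(1,1)$. Here $D(1,1)=\{z\in\mathbb{C}:|z-1|<1\}$, $\partial D(1,1)=\{z:|z-1|=1\}$, and $\overline{D(1,1)}$ is the closed disk. For $s>0$ and $\alpha\in\mathbb{C}$, $s^\alpha=e^{\alpha\log s}$ with the real logarithm. Equalities of functions hold for almost every $x\in(0,1)$. *)

theory Defs
  imports "HOL-Analysis.Analysis"
begin

section \<open>The space of square-integrable complex functions on the unit interval\<close>

abbreviation unit_ivl :: "real measure"
  where "unit_ivl \<equiv> lebesgue_on {0<..<1}"

definition square_integrable :: "(real \<Rightarrow> complex) \<Rightarrow> bool"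
  where "square_integrable f \<longleftrightarrow>
    f \<in> borel_measurable unit_ivl \<and> integrable unit_ivl (\<lambda>x. (cmod (f x))\<^sup>2)"

lemma square_integrable_measurable [measurable_dest]:
  "square_integrable f \<Longrightarrow> f \<in> borel_measurable unit_ivl"
  by (simp add: square_integrable_def)

lemma square_integrable_zero: "square_integrable (\<lambda>x. 0)"
  by (simp add: square_integrable_def)

lemma square_integrable_add:
  assumes "square_integrable f" "square_integrable g"
  shows "square_integrable (\<lambda>x. f x + g x)"
proof -
  note [measurable] = assms[THEN square_integrable_measurable]
  have "integrable unit_ivl (\<lambda>x. (cmod (f x + g x))\<^sup>2)"
  proof (rule Bochner_Integration.integrable_bound)
    show "integrable unit_ivl (\<lambda>x. 2 * (cmod (f x))\<^sup>2 + 2 * (cmod (g x))\<^sup>2)"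
      using assms by (auto simp: square_integrable_def)
    have "(cmod (f x + g x))\<^sup>2 \<le> 2 * (cmod (f x))\<^sup>2 + 2 * (cmod (g x))\<^sup>2" for x
    proof -
      have "(cmod (f x + g x))\<^sup>2 \<le> (cmod (f x) + cmod (g x))\<^sup>2"
        by (intro power_mono norm_triangle_ineq norm_ge_zero)
      also have "\<dots> \<le> 2 * (cmod (f x))\<^sup>2 + 2 * (cmod (g x))\<^sup>2"
        using sum_squares_bound[of "cmod (f x)" "cmod (g x)"] by (simp add: power2_sum)
      finally show ?thesis .
    qed
    then show "AE x in unit_ivl. norm ((cmod (f x + g x))\<^sup>2)
        \<le> norm (2 * (cmod (f x))\<^sup>2 + 2 * (cmod (g x))\<^sup>2)"
      by simp
  qed measurable
  then show ?thesis
    using assms by (simp add: square_integrable_def)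
qed

lemma square_integrable_cmult:
  assumes "square_integrable f"
  shows "square_integrable (\<lambda>x. c * f x)"
  using assms
  by (auto simp: square_integrable_def norm_mult power_mult_distrib intro!: borel_measurable_times)

lemma integrable_inner_square_integrable:
  assumes "square_integrable f" "square_integrable g"
  shows "integrable unit_ivl (\<lambda>x. f x \<bullet> g x)"
proof (rule Bochner_Integration.integrable_bound)
  note [measurable] = assms[THEN square_integrable_measurable]
  show "integrable unit_ivl (\<lambda>x. (cmod (f x))\<^sup>2 + (cmod (g x))\<^sup>2)"
    using assms by (auto simp: square_integrable_def)
  have "\<bar>f x \<bullet> g x\<bar> \<le> (cmod (f x))\<^sup>2 + (cmod (g x))\<^sup>2" for x
  proof -
    have "\<bar>f x \<bullet> g x\<bar> \<le> cmod (f x) * cmod (g x)"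
      by (rule Cauchy_Schwarz_ineq2)
    moreover have "0 \<le> cmod (f x) * cmod (g x)"
      by simp
    ultimately show ?thesis
      using sum_squares_bound[of "cmod (f x)" "cmod (g x)"] by linarith
  qed
  then show "AE x in unit_ivl. norm (f x \<bullet> g x) \<le> norm ((cmod (f x))\<^sup>2 + (cmod (g x))\<^sup>2)"
    by simp
  show "(\<lambda>x. f x \<bullet> g x) \<in> borel_measurable unit_ivl"
    by measurable
qed

text \<open>Only square-integrable functions represent elements; \<open>abs_L2 f\<close> is the class of such an \<open>f\<close>,
  and \<open>rep_L2\<close> picks an arbitrary representative, determined up to a null set. Functions are
  irrelevant outside \<open>(0,1)\<close>.\<close>

quotient_type L2 = "real \<Rightarrow> complex" / partial:
  "\<lambda>f g. square_integrable f \<and> square_integrable g \<and> (AE x in unit_ivl. f x = g x)"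
proof (rule part_equivpI)
  show "\<exists>f. square_integrable f \<and> square_integrable f \<and> (AE x in unit_ivl. f x = f x)"
    using square_integrable_zero by auto
  show "symp (\<lambda>f g. square_integrable f \<and> square_integrable g \<and> (AE x in unit_ivl. f x = g x))"
    by (rule sympI) (auto elim: eventually_mono)
  show "transp (\<lambda>f g. square_integrable f \<and> square_integrable g \<and> (AE x in unit_ivl. f x = g x))"
  proof (rule transpI)
    fix f g h :: "real \<Rightarrow> complex"
    assume 1: "square_integrable f \<and> square_integrable g \<and> (AE x in unit_ivl. f x = g x)"
      and 2: "square_integrable g \<and> square_integrable h \<and> (AE x in unit_ivl. g x = h x)"
    from 1 have a: "AE x in unit_ivl. f x = g x" by blast
    from 2 have b: "AE x in unit_ivl. g x = h x" by blast
    from a b have "AE x in unit_ivl. f x = h x" by eventually_elim simp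
    with 1 2 show "square_integrable f \<and> square_integrable h \<and> (AE x in unit_ivl. f x = h x)"
      by blast
  qed
qed

instantiation L2 :: real_inner
begin

lift_definition zero_L2 :: L2 is "\<lambda>x. 0"
  by (simp add: square_integrable_zero)

lift_definition plus_L2 :: "L2 \<Rightarrow> L2 \<Rightarrow> L2" is "\<lambda>f g x. f x + g x"
proof -
  fix f f' g g' :: "real \<Rightarrow> complex"
  assume *: "square_integrable f \<and> square_integrable f' \<and> (AE x in unit_ivl. f x = f' x)"
    "square_integrable g \<and> square_integrable g' \<and> (AE x in unit_ivl. g x = g' x)"
  from * have a: "AE x in unit_ivl. f x = f' x" and b: "AE x in unit_ivl. g x = g' x" by auto
  from a b have "AE x in unit_ivl. f x + g x = f' x + g' x" by eventually_elim simp
  with * show "square_integrable (\<lambda>x. f x + g x) \<and> square_integrable (\<lambda>x. f' x + g' x) \<and>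
      (AE x in unit_ivl. f x + g x = f' x + g' x)"
    by (auto intro: square_integrable_add)
qed

lift_definition uminus_L2 :: "L2 \<Rightarrow> L2" is "\<lambda>f x. - f x"
  using square_integrable_cmult[of _ "-1"] by (auto elim: eventually_mono)

definition minus_L2 :: "L2 \<Rightarrow> L2 \<Rightarrow> L2"
  where "minus_L2 f g = f + (- g)"

lift_definition scaleR_L2 :: "real \<Rightarrow> L2 \<Rightarrow> L2" is "\<lambda>c f x. c *\<^sub>R f x"
  unfolding scaleR_conv_of_real by (auto intro: square_integrable_cmult elim: eventually_mono)

text \<open>On \<^typ>\<open>complex\<close>, \<open>z \<bullet> w = Re (z * cnj w)\<close>, so this is the real part of the usual
  Hermitian inner product; it induces the usual norm.\<close>

lift_definition inner_L2 :: "L2 \<Rightarrow> L2 \<Rightarrow> real" is "\<lambda>f g. (\<integral>x. f x \<bullet> g x \<partial>unit_ivl)"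
proof -
  fix f f' g g' :: "real \<Rightarrow> complex"
  assume *: "square_integrable f \<and> square_integrable f' \<and> (AE x in unit_ivl. f x = f' x)"
    "square_integrable g \<and> square_integrable g' \<and> (AE x in unit_ivl. g x = g' x)"
  then have [measurable]: "f \<in> borel_measurable unit_ivl" "f' \<in> borel_measurable unit_ivl"
    "g \<in> borel_measurable unit_ivl" "g' \<in> borel_measurable unit_ivl"
    by (auto dest: square_integrable_measurable)
  from * have a: "AE x in unit_ivl. f x = f' x" and b: "AE x in unit_ivl. g x = g' x" by auto
  from a b have c: "AE x in unit_ivl. f x \<bullet> g x = f' x \<bullet> g' x" by eventually_elim simp
  show "(\<integral>x. f x \<bullet> g x \<partial>unit_ivl) = (\<integral>x. f' x \<bullet> g' x \<partial>unit_ivl)"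
    by (rule integral_cong_AE) (use c in \<open>measurable\<close>)
qed

definition norm_L2 :: "L2 \<Rightarrow> real"
  where "norm_L2 f = sqrt (f \<bullet> f)"

definition dist_L2 :: "L2 \<Rightarrow> L2 \<Rightarrow> real"
  where "dist_L2 f g = norm (f - g)"

definition sgn_L2 :: "L2 \<Rightarrow> L2"
  where "sgn_L2 f = scaleR (inverse (norm f)) f"

definition uniformity_L2 :: "(L2 \<times> L2) filter"
  where "uniformity_L2 = (INF e\<in>{0<..}. principal {(x, y). dist x y < e})"

definition open_L2 :: "L2 set \<Rightarrow> bool"
  where "open_L2 U \<longleftrightarrow> (\<forall>x\<in>U. eventually (\<lambda>(x', y). x' = x \<longrightarrow> y \<in> U) uniformity)"

instance
proof
  fix f g h :: L2 and a b :: real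
  show "f + g + h = f + (g + h)"
    by transfer (auto intro!: square_integrable_add simp: add.assoc)
  show "f + g = g + f"
    by transfer (auto intro!: square_integrable_add simp: add.commute)
  show "0 + f = f"
    by transfer auto
  show "- f + f = 0"
    by transfer (auto simp: square_integrable_zero)
  show "f - g = f + - g"
    by (rule minus_L2_def)
  show "a *\<^sub>R (f + g) = a *\<^sub>R f + a *\<^sub>R g"
    unfolding scaleR_conv_of_real
    by transfer (auto intro!: square_integrable_add square_integrable_cmult
        simp: scaleR_conv_of_real distrib_left)
  show "(a + b) *\<^sub>R f = a *\<^sub>R f + b *\<^sub>R f"
    by transfer (auto intro!: square_integrable_add square_integrable_cmult
        simp: scaleR_conv_of_real distrib_right)
  show "a *\<^sub>R b *\<^sub>R f = (a * b) *\<^sub>R f"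
    by transfer (auto intro!: square_integrable_cmult
        simp: scaleR_conv_of_real mult.assoc[symmetric] simp flip: of_real_mult)
  show "1 *\<^sub>R f = f"
    by transfer auto
  show "sgn f = inverse (norm f) *\<^sub>R f"
    by (simp add: sgn_L2_def)
  show "dist f g = norm (f - g)"
    by (rule dist_L2_def)
  show "(uniformity :: (L2 \<times> L2) filter) = (INF e\<in>{0<..}. principal {(x, y). dist x y < e})"
    by (rule uniformity_L2_def)
  show "open U \<longleftrightarrow> (\<forall>x\<in>U. \<forall>\<^sub>F (x', y) in uniformity. x' = x \<longrightarrow> y \<in> U)" for U :: "L2 set"
    by (rule open_L2_def)
  show "f \<bullet> g = g \<bullet> f"
    by transfer (simp add: inner_commute)
  show "(f + g) \<bullet> h = f \<bullet> h + g \<bullet> h"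
    by transfer (simp add: inner_add_left integrable_inner_square_integrable)
  show "a *\<^sub>R f \<bullet> g = a * (f \<bullet> g)"
    by transfer simp
  show "0 \<le> f \<bullet> f"
    by transfer simp
  show "f \<bullet> f = 0 \<longleftrightarrow> f = 0"
  proof transfer
    fix f :: "real \<Rightarrow> complex"
    assume *: "square_integrable f \<and> square_integrable f \<and> (AE x in unit_ivl. f x = f x)"
    then have "integral\<^sup>L unit_ivl (\<lambda>x. f x \<bullet> f x) = 0 \<longleftrightarrow> (AE x in unit_ivl. f x \<bullet> f x = 0)"
      by (intro integral_nonneg_eq_0_iff_AE) (auto intro: integrable_inner_square_integrable)
    with * show "(\<integral>x. f x \<bullet> f x \<partial>unit_ivl) = 0 \<longleftrightarrow>
        square_integrable f \<and> square_integrable (\<lambda>x. 0) \<and> (AE x in unit_ivl. f x = 0)"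
      by (simp add: square_integrable_zero)
  qed
  show "norm f = sqrt (f \<bullet> f)"
    by (rule norm_L2_def)
qed

end

lift_definition scaleC_L2 :: "complex \<Rightarrow> L2 \<Rightarrow> L2" (infixr "*\<^sub>C" 75) is "\<lambda>c f x. c * f x"
  by (auto intro: square_integrable_cmult elim: eventually_mono)

lemma norm_L2_squared_abs:
  assumes "square_integrable f"
  shows "(norm (abs_L2 f))\<^sup>2 = (\<integral>x. (cmod (f x))\<^sup>2 \<partial>unit_ivl)"
proof -
  have "abs_L2 f \<bullet> abs_L2 f = (\<integral>x. f x \<bullet> f x \<partial>unit_ivl)"
    by (rule inner_L2.abs_eq) (use assms in auto)
  then show ?thesis
    by (simp add: power2_norm_eq_inner)
qed

section \<open>Integral operators: the Schur test\<close>

lemma lebesgue_borel_AE: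
  fixes f :: "real \<Rightarrow> complex"
  assumes "f \<in> borel_measurable lebesgue"
  obtains g where "g \<in> borel_measurable borel" "AE x in lebesgue. f x = g x"
proof -
  have "(\<lambda>x. Re (f x)) \<in> borel_measurable lebesgue" "(\<lambda>x. Im (f x)) \<in> borel_measurable lebesgue"
    using assms by measurable
  then obtain u v where uv: "u \<in> borel_measurable lborel" "v \<in> borel_measurable lborel"
      and u: "AE x in lborel. Re (f x) = u x" and v: "AE x in lborel. Im (f x) = v x"
    using completion_ex_borel_measurable_real by metis
  show thesis
  proof
    show "(\<lambda>x. Complex (u x) (v x)) \<in> borel_measurable borel"
      using uv unfolding Complex_eq by measurable
    have "AE x in lborel. f x = Complex (u x) (v x)"
      using u v by eventually_elim (simp add: complex_eq_iff)
    then show "AE x in lebesgue. f x = Complex (u x) (v x)"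
      by (rule AE_completion)
  qed
qed

lemma ennreal_norm_integral_le:
  fixes f :: "'a \<Rightarrow> 'b::{banach, second_countable_topology}"
  shows "ennreal (norm (integral\<^sup>L M f)) \<le> (\<integral>\<^sup>+x. ennreal (norm (f x)) \<partial>M)"
proof (cases "integrable M f")
  case True
  then show ?thesis by (rule integral_norm_bound_ennreal)
next
  case False
  then show ?thesis by (simp add: not_integrable_integral_eq)
qed

lemma schur_test_nn:
  fixes k :: "real \<Rightarrow> real \<Rightarrow> real" and w :: "real \<Rightarrow> real" and F :: "real \<Rightarrow> ennreal"
  assumes k [measurable]: "case_prod k \<in> borel_measurable (borel \<Otimes>\<^sub>M borel)"
    and w [measurable]: "w \<in> borel_measurable borel"
    and F [measurable]: "F \<in> borel_measurable borel"
    and S [measurable]: "S \<in> sets borel"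
    and k0: "\<And>x t. 0 \<le> k x t" and w0: "\<And>t. t \<in> S \<Longrightarrow> 0 < w t"
    and A0: "0 \<le> A" and B0: "0 \<le> B"
    and A: "\<And>x. x \<in> S \<Longrightarrow> (\<integral>\<^sup>+t\<in>S. ennreal (k x t * w t) \<partial>lborel) \<le> ennreal (A * w x)"
    and B: "\<And>t. t \<in> S \<Longrightarrow> (\<integral>\<^sup>+x\<in>S. ennreal (k x t * w x) \<partial>lborel) \<le> ennreal (B * w t)"
  shows "(\<integral>\<^sup>+x\<in>S. (\<integral>\<^sup>+t\<in>S. ennreal (k x t) * F t \<partial>lborel)\<^sup>2 \<partial>lborel)
    \<le> ennreal (A * B) * (\<integral>\<^sup>+t\<in>S. (F t)\<^sup>2 \<partial>lborel)"
proof -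
  define G where "G x t = ennreal (k x t / w t) * (F t)\<^sup>2 * indicator S t" for x t
  have [measurable]: "case_prod G \<in> borel_measurable (borel \<Otimes>\<^sub>M borel)"
    unfolding G_def by measurable
  have 1: "(\<integral>\<^sup>+t\<in>S. ennreal (k x t) * F t \<partial>lborel)\<^sup>2 \<le> ennreal (A * w x) * (\<integral>\<^sup>+t. G x t \<partial>lborel)"
    if x: "x \<in> S" for x
  proof -
    let ?f = "\<lambda>t. ennreal (sqrt (k x t * w t)) * indicator S t"
    let ?g = "\<lambda>t. ennreal (sqrt (k x t / w t)) * F t * indicator S t"
    have "(\<integral>\<^sup>+t\<in>S. ennreal (k x t) * F t \<partial>lborel) = (\<integral>\<^sup>+t. ?f t * ?g t \<partial>lborel)"
    proof (rule nn_integral_cong)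
      fix t
      have "sqrt (k x t * w t) * sqrt (k x t / w t) = k x t" if "t \<in> S"
        using k0[of x t] w0[OF that] by (simp add: real_sqrt_mult[symmetric])
      then show "ennreal (k x t) * F t * indicator S t = ?f t * ?g t"
        using k0[of x t] w0[of t]
        by (auto simp: indicator_def mult.assoc[symmetric] ennreal_mult[symmetric])
    qed
    also have "(\<dots>)\<^sup>2 \<le> (\<integral>\<^sup>+t. (?f t)\<^sup>2 \<partial>lborel) * (\<integral>\<^sup>+t. (?g t)\<^sup>2 \<partial>lborel)"
      by (rule Cauchy_Schwarz_nn_integral) measurable
    also have "(\<integral>\<^sup>+t. (?f t)\<^sup>2 \<partial>lborel) = (\<integral>\<^sup>+t\<in>S. ennreal (k x t * w t) \<partial>lborel)"
      using k0 w0 by (intro nn_integral_cong) (auto simp: indicator_def ennreal_power less_imp_le)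
    also have "(\<integral>\<^sup>+t. (?g t)\<^sup>2 \<partial>lborel) = (\<integral>\<^sup>+t. G x t \<partial>lborel)"
      unfolding G_def using k0 w0
      by (intro nn_integral_cong)
         (auto simp: indicator_def ennreal_power less_imp_le power_mult_distrib)
    finally show ?thesis
      using A[OF x] by (meson mult_right_mono order_trans zero_le)
  qed
  have "(\<integral>\<^sup>+x\<in>S. (\<integral>\<^sup>+t\<in>S. ennreal (k x t) * F t \<partial>lborel)\<^sup>2 \<partial>lborel)
      \<le> (\<integral>\<^sup>+x. (\<integral>\<^sup>+t. ennreal (A * w x) * indicator S x * G x t \<partial>lborel) \<partial>lborel)"
  proof (rule nn_integral_mono)
    fix x
    have "(\<integral>\<^sup>+t. ennreal (A * w x) * indicator S x * G x t \<partial>lborel)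
        = ennreal (A * w x) * indicator S x * (\<integral>\<^sup>+t. G x t \<partial>lborel)"
      by (rule nn_integral_cmult) measurable
    then show "(\<integral>\<^sup>+t\<in>S. ennreal (k x t) * F t \<partial>lborel)\<^sup>2 * indicator S x
        \<le> (\<integral>\<^sup>+t. ennreal (A * w x) * indicator S x * G x t \<partial>lborel)"
      using 1[of x] by (simp add: indicator_def)
  qed
  also have "\<dots> = (\<integral>\<^sup>+t. (\<integral>\<^sup>+x. ennreal (A * w x) * indicator S x * G x t \<partial>lborel) \<partial>lborel)"
    by (rule lborel_pair.Fubini') measurable
  also have "\<dots> \<le> (\<integral>\<^sup>+t. ennreal (A * B) * ((F t)\<^sup>2 * indicator S t) \<partial>lborel)"
  proof (rule nn_integral_mono)
    fix t
    show "(\<integral>\<^sup>+x. ennreal (A * w x) * indicator S x * G x t \<partial>lborel)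
        \<le> ennreal (A * B) * ((F t)\<^sup>2 * indicator S t)"
    proof (cases "t \<in> S")
      case True
      have "(\<integral>\<^sup>+x. ennreal (A * w x) * indicator S x * G x t \<partial>lborel)
          = (\<integral>\<^sup>+x. (ennreal (A / w t) * (F t)\<^sup>2) * (ennreal (k x t * w x) * indicator S x) \<partial>lborel)"
      proof (rule nn_integral_cong)
        fix x
        have "ennreal (A * w x) * ennreal (k x t / w t) = ennreal (A / w t) * ennreal (k x t * w x)"
          if "x \<in> S"
          using k0[of x t] w0[OF that] w0[OF True] A0 by (simp add: ennreal_mult[symmetric] field_simps)
        then show "ennreal (A * w x) * indicator S x * G x t
            = (ennreal (A / w t) * (F t)\<^sup>2) * (ennreal (k x t * w x) * indicator S x)"
          using True by (auto simp: G_def indicator_def mult.assoc[symmetric])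
            (simp add: mult.assoc mult.commute[of "(F t)\<^sup>2"])
      qed
      also have "\<dots> = (ennreal (A / w t) * (F t)\<^sup>2) * (\<integral>\<^sup>+x\<in>S. ennreal (k x t * w x) \<partial>lborel)"
        by (rule nn_integral_cmult) measurable
      also have "\<dots> \<le> (ennreal (A / w t) * (F t)\<^sup>2) * ennreal (B * w t)"
        by (intro mult_left_mono B True) auto
      also have "\<dots> = (ennreal (A / w t) * ennreal (B * w t)) * (F t)\<^sup>2"
        by (simp add: ac_simps)
      also have "ennreal (A / w t) * ennreal (B * w t) = ennreal (A * B)"
        using w0[OF True] A0 B0 by (simp add: ennreal_mult[symmetric])
      finally show ?thesis
        using True by simp
    qed (simp add: G_def)
  qed
  also have "\<dots> = ennreal (A * B) * (\<integral>\<^sup>+t\<in>S. (F t)\<^sup>2 \<partial>lborel)"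
    by (rule nn_integral_cmult) measurable
  finally show ?thesis .
qed

lemma schur_test:
  fixes \<kappa> :: "real \<Rightarrow> real \<Rightarrow> complex" and w :: "real \<Rightarrow> real" and f :: "real \<Rightarrow> complex"
  defines "S \<equiv> {0<..<1::real}"
  assumes k [measurable]: "case_prod \<kappa> \<in> borel_measurable (borel \<Otimes>\<^sub>M borel)"
    and w [measurable]: "w \<in> borel_measurable borel"
    and w0: "\<And>t. t \<in> S \<Longrightarrow> 0 < w t"
    and A0: "0 \<le> A" and B0: "0 \<le> B"
    and A: "\<And>x. x \<in> S \<Longrightarrow> (\<integral>\<^sup>+t\<in>S. ennreal (cmod (\<kappa> x t) * w t) \<partial>lborel) \<le> ennreal (A * w x)"
    and B: "\<And>t. t \<in> S \<Longrightarrow> (\<integral>\<^sup>+x\<in>S. ennreal (cmod (\<kappa> x t) * w x) \<partial>lborel) \<le> ennreal (B * w t)"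
    and f: "square_integrable f"
  shows "square_integrable (\<lambda>x. \<integral>t. \<kappa> x t * f t \<partial>unit_ivl)"
    and "(\<integral>x. (cmod (\<integral>t. \<kappa> x t * f t \<partial>unit_ivl))\<^sup>2 \<partial>unit_ivl)
      \<le> A * B * (\<integral>x. (cmod (f x))\<^sup>2 \<partial>unit_ivl)"
    and "AE x in unit_ivl. integrable unit_ivl (\<lambda>t. \<kappa> x t * f t)"
proof -
  have S [measurable]: "S \<in> sets borel" "S \<in> sets lebesgue"
    by (auto simp: S_def)
  have fm: "f \<in> borel_measurable unit_ivl" and fi: "integrable unit_ivl (\<lambda>x. (cmod (f x))\<^sup>2)"
    using f by (auto simp: square_integrable_def)
  have "(\<lambda>x. indicator S x *\<^sub>R f x) \<in> borel_measurable lebesgue"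
    using fm by (simp add: borel_measurable_restrict_space_iff S_def)
  then obtain g where g [measurable]: "g \<in> borel_measurable borel"
      and fg: "AE x in lebesgue. indicator S x *\<^sub>R f x = g x"
    by (rule lebesgue_borel_AE)
  have fgS: "AE x in unit_ivl. f x = g x"
    using fg by (subst AE_restrict_space_iff) (auto elim!: eventually_mono simp: S_def)
  have nn_ivl: "(\<integral>\<^sup>+x. h x \<partial>unit_ivl) = (\<integral>\<^sup>+x\<in>S. h x \<partial>lborel)" for h
    by (simp add: nn_integral_restrict_space S_def nn_integral_completion)
  define T where "T x = (\<integral>t. indicator S t *\<^sub>R (\<kappa> x t * g t) \<partial>lborel)" for x
  have [measurable]: "T \<in> borel_measurable borel"
    unfolding T_def by measurable
  have Tm: "T \<in> borel_measurable unit_ivl"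
    by (intro measurable_restrict_space1 measurable_completion) simp
  have [measurable]: "\<kappa> x \<in> borel_measurable borel" for x
    by measurable
  have km: "(\<lambda>t. \<kappa> x t * h t) \<in> borel_measurable unit_ivl" if "h \<in> borel_measurable unit_ivl" for x h
  proof (rule borel_measurable_times[OF _ that])
    show "\<kappa> x \<in> borel_measurable unit_ivl"
      by (intro measurable_restrict_space1 measurable_completion) simp
  qed
  have gm: "g \<in> borel_measurable unit_ivl"
    by (intro measurable_restrict_space1 measurable_completion) simp
  have kfg: "AE t in unit_ivl. \<kappa> x t * f t = \<kappa> x t * g t" for x
    using fgS by eventually_elim simp
  have T: "(\<integral>t. \<kappa> x t * f t \<partial>unit_ivl) = T x" for x
  proof -
    have "(\<integral>t. \<kappa> x t * f t \<partial>unit_ivl) = (\<integral>t. \<kappa> x t * g t \<partial>unit_ivl)"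
      by (intro integral_cong_AE km fm gm kfg)
    also have "\<dots> = (\<integral>t. indicator S t *\<^sub>R (\<kappa> x t * g t) \<partial>lebesgue)"
      by (simp add: integral_restrict_space S_def)
    also have "\<dots> = T x"
      unfolding T_def by (rule integral_completion) measurable
    finally show ?thesis .
  qed
  define F where "F t = ennreal (cmod (g t))" for t
  have [measurable]: "F \<in> borel_measurable borel"
    unfolding F_def by measurable
  define N where "N = (\<integral>x. (cmod (f x))\<^sup>2 \<partial>unit_ivl)"
  have N0: "0 \<le> N"
    unfolding N_def by simp
  have "(\<integral>\<^sup>+t\<in>S. (F t)\<^sup>2 \<partial>lborel) = (\<integral>\<^sup>+t. ennreal ((cmod (g t))\<^sup>2) \<partial>unit_ivl)"
    unfolding nn_ivl by (simp add: F_def ennreal_power)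
  also have "\<dots> = (\<integral>\<^sup>+t. ennreal ((cmod (f t))\<^sup>2) \<partial>unit_ivl)"
    by (rule nn_integral_cong_AE) (use fgS in \<open>auto elim!: eventually_mono\<close>)
  also have "\<dots> = ennreal N"
    unfolding N_def by (rule nn_integral_eq_integral[OF fi]) simp
  finally have FN: "(\<integral>\<^sup>+t\<in>S. (F t)\<^sup>2 \<partial>lborel) = ennreal N" .
  define H where "H x = (\<integral>\<^sup>+t\<in>S. ennreal (cmod (\<kappa> x t)) * F t \<partial>lborel)" for x
  have [measurable]: "H \<in> borel_measurable borel"
    unfolding H_def by measurable
  have H: "(\<integral>\<^sup>+x\<in>S. (H x)\<^sup>2 \<partial>lborel) \<le> ennreal (A * B * N)"
    using schur_test_nn[of "\<lambda>x t. cmod (\<kappa> x t)" w F S A B] w0 A0 B0 A B N0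
    by (simp add: H_def FN ennreal_mult)
  have TH: "ennreal (cmod (T x)) \<le> H x" for x
  proof -
    have "ennreal (cmod (T x)) \<le> (\<integral>\<^sup>+t. ennreal (cmod (indicator S t *\<^sub>R (\<kappa> x t * g t))) \<partial>lborel)"
      unfolding T_def by (rule ennreal_norm_integral_le)
    also have "\<dots> = H x"
      unfolding H_def F_def
      by (intro nn_integral_cong) (auto simp: indicator_def norm_mult ennreal_mult)
    finally show ?thesis .
  qed
  have TN: "(\<integral>\<^sup>+x. ennreal ((cmod (T x))\<^sup>2) \<partial>unit_ivl) \<le> ennreal (A * B * N)"
  proof -
    have "(\<integral>\<^sup>+x. ennreal ((cmod (T x))\<^sup>2) \<partial>unit_ivl) \<le> (\<integral>\<^sup>+x\<in>S. (H x)\<^sup>2 \<partial>lborel)"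
      unfolding nn_ivl using TH
      by (intro nn_integral_mono mult_right_mono) (auto simp flip: ennreal_power intro: power_mono)
    from this H show ?thesis
      by (rule order_trans)
  qed
  have Ti: "integrable unit_ivl (\<lambda>x. (cmod (T x))\<^sup>2)"
  proof (rule integrableI_bounded)
    show "(\<lambda>x. (cmod (T x))\<^sup>2) \<in> borel_measurable unit_ivl"
      using Tm by measurable
    show "(\<integral>\<^sup>+x. ennreal (norm ((cmod (T x))\<^sup>2)) \<partial>unit_ivl) < \<infinity>"
      using TN by (simp add: order_le_less_trans)
  qed
  show "square_integrable (\<lambda>x. \<integral>t. \<kappa> x t * f t \<partial>unit_ivl)"
    using Tm Ti by (simp add: T square_integrable_def)
  have "ennreal (\<integral>x. (cmod (T x))\<^sup>2 \<partial>unit_ivl) \<le> ennreal (A * B * N)"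
    using TN by (subst nn_integral_eq_integral[symmetric]) (auto intro: Ti)
  then show "(\<integral>x. (cmod (\<integral>t. \<kappa> x t * f t \<partial>unit_ivl))\<^sup>2 \<partial>unit_ivl)
      \<le> A * B * (\<integral>x. (cmod (f x))\<^sup>2 \<partial>unit_ivl)"
    using A0 B0 N0 by (simp add: T N_def[symmetric])
  have "AE x in lborel. (H x)\<^sup>2 * indicator S x \<noteq> \<infinity>"
    using H by (intro nn_integral_noteq_infinite) (auto simp: top_unique)
  then have "AE x in lebesgue. (H x)\<^sup>2 * indicator S x \<noteq> \<infinity>"
    by (rule AE_completion)
  then have "AE x in unit_ivl. (H x)\<^sup>2 \<noteq> \<infinity>"
    by (subst AE_restrict_space_iff) (auto elim!: eventually_mono simp: S_def)
  then have "AE x in unit_ivl. H x < \<infinity>"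
    by eventually_elim (auto simp: power_eq_top_ennreal top.not_eq_extremum)
  then show "AE x in unit_ivl. integrable unit_ivl (\<lambda>t. \<kappa> x t * f t)"
  proof eventually_elim
    case (elim x)
    have "integrable unit_ivl (\<lambda>t. \<kappa> x t * g t)"
    proof (rule integrableI_bounded)
      show "(\<lambda>t. \<kappa> x t * g t) \<in> borel_measurable unit_ivl"
        by (rule km[OF gm])
      show "(\<integral>\<^sup>+t. ennreal (norm (\<kappa> x t * g t)) \<partial>unit_ivl) < \<infinity>"
        unfolding nn_ivl using elim by (simp add: H_def F_def norm_mult ennreal_mult)
    qed
    then show ?case
      by (subst integrable_cong_AE[OF km[OF fm] km[OF gm] kfg])
  qed
qed

section \<open>The Cesaro operator\<close>

text \<open>Boundedness on \<^typ>\<open>L2\<close> is the Schur test with weight \<open>(t * (1 - t)) powr (-1/2)\<close>, for which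
  both weighted kernel integrals equal twice the weight.\<close>

lemma nn_integral_FTC_Ioo:
  fixes f F :: "real \<Rightarrow> real"
  assumes ab: "a < b"
    and F: "\<And>x. a < x \<Longrightarrow> x < b \<Longrightarrow> (F has_real_derivative f x) (at x)"
    and f: "\<And>x. a < x \<Longrightarrow> x < b \<Longrightarrow> isCont f x"
    and f0: "\<And>x. a < x \<Longrightarrow> x < b \<Longrightarrow> 0 \<le> f x"
    and A: "(F \<longlongrightarrow> A) (at_right a)" and B: "(F \<longlongrightarrow> B) (at_left b)"
  shows "(\<integral>\<^sup>+x\<in>{a<..<b}. ennreal (f x) \<partial>lborel) = ennreal (B - A)"
proof -
  have "set_integrable lborel (einterval (ereal a) (ereal b)) f"
    "(LBINT x=ereal a..ereal b. f x) = B - A"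
    by (rule interval_integral_FTC_nonneg[of _ _ F];
        use assms in \<open>simp add: ereal_tendsto_simps\<close>)+
  then have i: "integrable lborel (\<lambda>x. indicator {a<..<b} x *\<^sub>R f x)"
    and v: "(\<integral>x. indicator {a<..<b} x *\<^sub>R f x \<partial>lborel) = B - A"
    using ab by (simp_all add: set_integrable_def interval_lebesgue_integral_def
        set_lebesgue_integral_def)
  have "(\<integral>\<^sup>+x\<in>{a<..<b}. ennreal (f x) \<partial>lborel)
      = (\<integral>\<^sup>+x. ennreal (indicator {a<..<b} x *\<^sub>R f x) \<partial>lborel)"
    by (intro nn_integral_cong) (auto simp: indicator_def)
  also have "\<dots> = ennreal (B - A)"
    unfolding v[symmetric] by (rule nn_integral_eq_integral[OF i]) (auto simp: indicator_def f0)
  finally show ?thesis .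
qed

definition cesaro_kernel :: "real \<Rightarrow> real \<Rightarrow> complex"
  where "cesaro_kernel x t = (if 0 < t \<and> t < x then 1 / of_real (x * (1 - t)) else 0)"

definition cesaro_weight :: "real \<Rightarrow> real"
  where "cesaro_weight t = 1 / (sqrt t * sqrt (1 - t))"

lemma cesaro_weight_left:
  assumes "0 < x" "x < 1"
  shows "(\<integral>\<^sup>+t\<in>{0<..<1}. ennreal (cmod (cesaro_kernel x t) * cesaro_weight t) \<partial>lborel)
    \<le> ennreal (2 * cesaro_weight x)"
proof -
  define f where "f t = 1 / (x * (1 - t)) * cesaro_weight t" for t
  define F where "F t = 2 / x * (sqrt t / sqrt (1 - t))" for t
  have "(\<integral>\<^sup>+t\<in>{0<..<1}. ennreal (cmod (cesaro_kernel x t) * cesaro_weight t) \<partial>lborel)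
      = (\<integral>\<^sup>+t\<in>{0<..<x}. ennreal (f t) \<partial>lborel)"
    using assms by (intro nn_integral_cong)
      (auto simp: indicator_def f_def cesaro_kernel_def norm_divide norm_mult simp flip: of_real_diff)
  also have "\<dots> = ennreal (F x - F 0)"
  proof (rule nn_integral_FTC_Ioo[OF assms(1), of F])
    fix t assume t: "0 < t" "t < x"
    then have s: "0 < sqrt t" "0 < sqrt (1 - t)" "sqrt t * sqrt t = t"
        "sqrt (1 - t) * sqrt (1 - t) = 1 - t"
      using assms by auto
    have "(F has_real_derivative
        2 / x * ((inverse (sqrt t) / 2 * sqrt (1 - t) - sqrt t * (inverse (sqrt (1 - t)) / 2 * (0 - 1)))
          / (sqrt (1 - t) * sqrt (1 - t)))) (at t)"
      unfolding F_def using t assms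
      by (intro DERIV_cmult DERIV_divide) (auto intro!: derivative_eq_intros)
    also have "(inverse (sqrt t) / 2 * sqrt (1 - t) - sqrt t * (inverse (sqrt (1 - t)) / 2 * (0 - 1)))
        = (sqrt (1 - t) * sqrt (1 - t) + sqrt t * sqrt t) / (2 * sqrt t * sqrt (1 - t))"
      using s(1,2) by (simp add: field_simps)
    also have "2 / x * (\<dots> / (sqrt (1 - t) * sqrt (1 - t))) = f t"
      unfolding s(3,4) using s(1,2) t assms by (simp add: f_def cesaro_weight_def field_simps)
    finally show "(F has_real_derivative f t) (at t)" .
    show "isCont f t" "0 \<le> f t"
      unfolding f_def cesaro_weight_def using t assms by (auto intro!: continuous_intros)
  next
    show "(F \<longlongrightarrow> F 0) (at_right 0)"
      unfolding F_def by (rule tendsto_eq_intros refl | simp)+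
    show "(F \<longlongrightarrow> F x) (at_left x)"
      unfolding F_def using assms by (auto intro!: tendsto_intros)
  qed
  also have "F x - F 0 = 2 * cesaro_weight x"
  proof -
    have "sqrt x * sqrt x = x" "0 < sqrt x" "0 < sqrt (1 - x)"
      using assms by auto
    then show ?thesis
      unfolding F_def cesaro_weight_def using assms by (simp add: field_simps)
  qed
  finally show ?thesis
    by simp
qed

lemma cesaro_weight_right:
  assumes "0 < t" "t < 1"
  shows "(\<integral>\<^sup>+x\<in>{0<..<1}. ennreal (cmod (cesaro_kernel x t) * cesaro_weight x) \<partial>lborel)
    \<le> ennreal (2 * cesaro_weight t)"
proof -
  define f where "f x = 1 / (x * (1 - t)) * cesaro_weight x" for x
  define F where "F x = - 2 / (1 - t) * (sqrt (1 - x) / sqrt x)" for x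
  have "(\<integral>\<^sup>+x\<in>{0<..<1}. ennreal (cmod (cesaro_kernel x t) * cesaro_weight x) \<partial>lborel)
      = (\<integral>\<^sup>+x\<in>{t<..<1}. ennreal (f x) \<partial>lborel)"
    using assms by (intro nn_integral_cong)
      (auto simp: indicator_def f_def cesaro_kernel_def norm_divide norm_mult simp flip: of_real_diff)
  also have "\<dots> = ennreal (F 1 - F t)"
  proof (rule nn_integral_FTC_Ioo[OF assms(2), of F])
    fix x assume x: "t < x" "x < 1"
    then have s: "0 < sqrt x" "0 < sqrt (1 - x)" "sqrt x * sqrt x = x"
        "sqrt (1 - x) * sqrt (1 - x) = 1 - x"
      using assms by auto
    have "(F has_real_derivative
        - 2 / (1 - t) * ((inverse (sqrt (1 - x)) / 2 * (0 - 1) * sqrt x - sqrt (1 - x) * (inverse (sqrt x) / 2))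
          / (sqrt x * sqrt x))) (at x)"
      unfolding F_def using x assms
      by (intro DERIV_cmult DERIV_divide) (auto intro!: derivative_eq_intros)
    also have "(inverse (sqrt (1 - x)) / 2 * (0 - 1) * sqrt x - sqrt (1 - x) * (inverse (sqrt x) / 2))
        = - (sqrt (1 - x) * sqrt (1 - x) + sqrt x * sqrt x) / (2 * sqrt x * sqrt (1 - x))"
      using s(1,2) by (simp add: field_simps)
    also have "- 2 / (1 - t) * (\<dots> / (sqrt x * sqrt x)) = f x"
      unfolding s(3,4) using s(1,2) x assms by (simp add: f_def cesaro_weight_def field_simps)
    finally show "(F has_real_derivative f x) (at x)" .
    show "isCont f x" "0 \<le> f x"
      unfolding f_def cesaro_weight_def using x assms by (auto intro!: continuous_intros)
  next
    show "(F \<longlongrightarrow> F t) (at_right t)"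
      unfolding F_def using assms by (auto intro!: tendsto_intros)
    show "(F \<longlongrightarrow> F 1) (at_left 1)"
      unfolding F_def by (rule tendsto_eq_intros refl | simp)+
  qed
  also have "F 1 - F t = 2 * cesaro_weight t"
  proof -
    have "sqrt (1 - t) * sqrt (1 - t) = 1 - t" "0 < sqrt t" "0 < sqrt (1 - t)"
      using assms by auto
    then show ?thesis
      unfolding F_def cesaro_weight_def using assms by (simp add: field_simps)
  qed
  finally show ?thesis
    by simp
qed

definition cesaro_fun :: "(real \<Rightarrow> complex) \<Rightarrow> real \<Rightarrow> complex"
  where "cesaro_fun f x = 1 / of_real x * (\<integral>t. f t / of_real (1 - t) \<partial>lebesgue_on {0<..<x})"

lemma cesaro_fun_kernel:
  assumes "0 < x" "x < 1"
  shows "cesaro_fun f x = (\<integral>t. cesaro_kernel x t * f t \<partial>unit_ivl)"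
proof -
  have "(\<integral>t. cesaro_kernel x t * f t \<partial>unit_ivl)
      = (\<integral>t. indicator {0<..<1} t *\<^sub>R (cesaro_kernel x t * f t) \<partial>lebesgue)"
    by (simp add: integral_restrict_space)
  also have "\<dots> = (\<integral>t. 1 / of_real x * (indicator {0<..<x} t *\<^sub>R (f t / of_real (1 - t))) \<partial>lebesgue)"
    using assms by (intro Bochner_Integration.integral_cong)
      (auto simp: indicator_def cesaro_kernel_def)
  also have "\<dots> = 1 / of_real x * (\<integral>t. indicator {0<..<x} t *\<^sub>R (f t / of_real (1 - t)) \<partial>lebesgue)"
    by (rule integral_mult_right_zero)
  also have "\<dots> = cesaro_fun f x"
    by (simp add: cesaro_fun_def integral_restrict_space)
  finally show ?thesis ..
qed

lemma cesaro_schur: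
  assumes f: "square_integrable f"
  shows "square_integrable (\<lambda>x. \<integral>t. cesaro_kernel x t * f t \<partial>unit_ivl)"
    and "(\<integral>x. (cmod (\<integral>t. cesaro_kernel x t * f t \<partial>unit_ivl))\<^sup>2 \<partial>unit_ivl)
      \<le> 2 * 2 * (\<integral>x. (cmod (f x))\<^sup>2 \<partial>unit_ivl)"
    and "AE x in unit_ivl. integrable unit_ivl (\<lambda>t. cesaro_kernel x t * f t)"
proof -
  have k: "case_prod cesaro_kernel \<in> borel_measurable (borel \<Otimes>\<^sub>M borel)"
    unfolding cesaro_kernel_def by measurable
  have w: "cesaro_weight \<in> borel_measurable borel"
    unfolding cesaro_weight_def by measurable
  note schur = schur_test[OF k w _ _ _ cesaro_weight_left cesaro_weight_right f]
  show "square_integrable (\<lambda>x. \<integral>t. cesaro_kernel x t * f t \<partial>unit_ivl)"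
    by (rule schur(1)) (auto simp: cesaro_weight_def)
  show "(\<integral>x. (cmod (\<integral>t. cesaro_kernel x t * f t \<partial>unit_ivl))\<^sup>2 \<partial>unit_ivl)
      \<le> 2 * 2 * (\<integral>x. (cmod (f x))\<^sup>2 \<partial>unit_ivl)"
    by (rule schur(2)) (auto simp: cesaro_weight_def)
  show "AE x in unit_ivl. integrable unit_ivl (\<lambda>t. cesaro_kernel x t * f t)"
    by (rule schur(3)) (auto simp: cesaro_weight_def)
qed

lemma square_integrable_cong:
  assumes "\<And>x. 0 < x \<Longrightarrow> x < 1 \<Longrightarrow> f x = g x"
  shows "square_integrable f \<longleftrightarrow> square_integrable g"
proof -
  have "f \<in> borel_measurable unit_ivl \<longleftrightarrow> g \<in> borel_measurable unit_ivl"
    by (rule measurable_cong) (simp add: assms)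
  moreover have "integrable unit_ivl (\<lambda>x. (cmod (f x))\<^sup>2) \<longleftrightarrow> integrable unit_ivl (\<lambda>x. (cmod (g x))\<^sup>2)"
    by (rule Bochner_Integration.integrable_cong) (simp_all add: assms)
  ultimately show ?thesis
    by (simp add: square_integrable_def)
qed

lemma square_integrable_cesaro_fun:
  assumes "square_integrable f"
  shows "square_integrable (cesaro_fun f)"
  using cesaro_schur(1)[OF assms] by (subst square_integrable_cong[OF cesaro_fun_kernel]) auto

lemma cesaro_fun_bound:
  assumes "square_integrable f"
  shows "(\<integral>x. (cmod (cesaro_fun f x))\<^sup>2 \<partial>unit_ivl) \<le> 2\<^sup>2 * (\<integral>x. (cmod (f x))\<^sup>2 \<partial>unit_ivl)"
proof -
  have "(\<integral>x. (cmod (cesaro_fun f x))\<^sup>2 \<partial>unit_ivl)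
      = (\<integral>x. (cmod (\<integral>t. cesaro_kernel x t * f t \<partial>unit_ivl))\<^sup>2 \<partial>unit_ivl)"
    by (intro Bochner_Integration.integral_cong refl) (simp add: cesaro_fun_kernel)
  with cesaro_schur(2)[OF assms] show ?thesis
    by simp
qed

lemma cesaro_fun_cong_AE:
  assumes f: "square_integrable f" and g: "square_integrable g" and fg: "AE x in unit_ivl. f x = g x"
    and x: "0 < x" "x < 1"
  shows "cesaro_fun f x = cesaro_fun g x"
proof -
  have k: "cesaro_kernel x \<in> borel_measurable unit_ivl"
    unfolding cesaro_kernel_def
    by (intro measurable_restrict_space1 measurable_completion) measurable
  have "AE t in unit_ivl. cesaro_kernel x t * f t = cesaro_kernel x t * g t"
    using fg by eventually_elim simp
  then have "(\<integral>t. cesaro_kernel x t * f t \<partial>unit_ivl) = (\<integral>t. cesaro_kernel x t * g t \<partial>unit_ivl)"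
    using f g k by (intro integral_cong_AE borel_measurable_times) (auto simp: square_integrable_def)
  then show ?thesis
    using x by (simp add: cesaro_fun_kernel)
qed

lift_definition cesaro_map :: "L2 \<Rightarrow> L2" is cesaro_fun
proof -
  fix f g :: "real \<Rightarrow> complex"
  assume *: "square_integrable f \<and> square_integrable g \<and> (AE x in unit_ivl. f x = g x)"
  then have "cesaro_fun f x = cesaro_fun g x" if "x \<in> {0<..<1}" for x
    using that by (intro cesaro_fun_cong_AE) auto
  then have "AE x in unit_ivl. cesaro_fun f x = cesaro_fun g x"
    by (intro AE_I2) simp
  with * show "square_integrable (cesaro_fun f) \<and> square_integrable (cesaro_fun g) \<and>
      (AE x in unit_ivl. cesaro_fun f x = cesaro_fun g x)"
    by (simp add: square_integrable_cesaro_fun)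
qed

lemma cesaro_fun_add_AE:
  assumes "square_integrable f" "square_integrable g"
  shows "AE x in unit_ivl. cesaro_fun (\<lambda>t. f t + g t) x = cesaro_fun f x + cesaro_fun g x"
proof -
  have "AE x in unit_ivl. x \<in> {0<..<1}"
    by (intro AE_I2) simp
  with cesaro_schur(3)[OF assms(1)] cesaro_schur(3)[OF assms(2)] show ?thesis
  proof eventually_elim
    case (elim x)
    then show ?case
      by (simp add: cesaro_fun_kernel distrib_left)
  qed
qed

lemma cesaro_fun_cmult: "cesaro_fun (\<lambda>t. c * f t) x = c * cesaro_fun f x"
proof -
  have "(\<integral>t. c * f t / of_real (1 - t) \<partial>lebesgue_on {0<..<x})
      = c * (\<integral>t. f t / of_real (1 - t) \<partial>lebesgue_on {0<..<x})"
    unfolding times_divide_eq_right[symmetric] by (rule integral_mult_right_zero)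
  then show ?thesis
    by (simp add: cesaro_fun_def)
qed

lemma norm_cesaro_map: "norm (cesaro_map f) \<le> norm f * 2"
proof -
  have "cesaro_map f \<bullet> cesaro_map f \<le> 2\<^sup>2 * (f \<bullet> f)"
    by transfer (use cesaro_fun_bound in \<open>simp add: power2_norm_eq_inner\<close>)
  then have "(norm (cesaro_map f))\<^sup>2 \<le> (norm f * 2)\<^sup>2"
    by (simp add: power2_norm_eq_inner power_mult_distrib)
  then show ?thesis
    by (rule power2_le_imp_le) simp
qed

lemma cesaro_map_scaleC: "cesaro_map (c *\<^sub>C f) = c *\<^sub>C cesaro_map f"
  by transfer (auto simp: cesaro_fun_cmult square_integrable_cmult square_integrable_cesaro_fun)

lift_definition cesaro :: "L2 \<Rightarrow>\<^sub>L L2" is cesaro_map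
proof (rule bounded_linear_intro)
  show "cesaro_map (f + g) = cesaro_map f + cesaro_map g" for f g
    by transfer (auto simp: cesaro_fun_add_AE square_integrable_add square_integrable_cesaro_fun)
  show "cesaro_map (r *\<^sub>R f) = r *\<^sub>R cesaro_map f" for r f
    by transfer (auto simp: scaleR_conv_of_real cesaro_fun_cmult square_integrable_cmult
        square_integrable_cesaro_fun)
  show "norm (cesaro_map f) \<le> norm f * 2" for f
    by (rule norm_cesaro_map)
qed

section \<open>Inverses and spectrum\<close>

lemma vector_space_L2: "vector_space ((*\<^sub>C) :: complex \<Rightarrow> L2 \<Rightarrow> L2)"
proof
  show "c *\<^sub>C (f + g) = c *\<^sub>C f + c *\<^sub>C g" for c f g
    by transfer (auto simp: distrib_left intro!: square_integrable_add square_integrable_cmult)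
  show "(c + d) *\<^sub>C f = c *\<^sub>C f + d *\<^sub>C f" for c d f
    by transfer (auto simp: distrib_right intro!: square_integrable_add square_integrable_cmult)
  show "c *\<^sub>C d *\<^sub>C f = (c * d) *\<^sub>C f" for c d f
    by transfer (auto simp: mult.assoc intro!: square_integrable_cmult)
  show "1 *\<^sub>C f = f" for f
    by transfer auto
qed

lift_definition cscale :: "complex \<Rightarrow> L2 \<Rightarrow>\<^sub>L L2" is "\<lambda>c f. c *\<^sub>C f"
proof -
  fix c :: complex
  show "bounded_linear ((*\<^sub>C) c)"
  proof (rule bounded_linear_intro)
    show "c *\<^sub>C (f + g) = c *\<^sub>C f + c *\<^sub>C g" for f g
      by transfer (auto simp: distrib_left intro!: square_integrable_add square_integrable_cmult)
    show "c *\<^sub>C (r *\<^sub>R f) = r *\<^sub>R (c *\<^sub>C f)" for r f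
      by transfer (auto simp: scaleR_conv_of_real mult.left_commute intro!: square_integrable_cmult)
    have "(norm (c *\<^sub>C f))\<^sup>2 = (norm f * cmod c)\<^sup>2" for f
    proof -
      have "(c *\<^sub>C f) \<bullet> (c *\<^sub>C f) = (cmod c)\<^sup>2 * (f \<bullet> f)"
        by transfer (simp flip: power2_norm_eq_inner add: norm_mult power_mult_distrib)
      then show ?thesis
        by (simp add: power2_norm_eq_inner power_mult_distrib)
    qed
    then show "norm (c *\<^sub>C f) \<le> norm f * cmod c" for f
      by (rule power2_le_imp_le[OF eq_refl]) simp
  qed
qed

definition is_inverse :: "(L2 \<Rightarrow>\<^sub>L L2) \<Rightarrow> (L2 \<Rightarrow>\<^sub>L L2) \<Rightarrow> bool"
  where "is_inverse T R \<longleftrightarrow> R o\<^sub>L T = id_blinfun \<and> T o\<^sub>L R = id_blinfun"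

lemma is_inverse_unique:
  assumes "is_inverse T R" "is_inverse T R'"
  shows "R = R'"
proof (rule blinfun_eqI)
  fix f
  have "R f = R (T (R' f))"
    using assms(2) unfolding is_inverse_def by (metis blinfun_apply_blinfun_compose blinfun_apply_id_blinfun id_apply)
  also have "\<dots> = R' f"
    using assms(1) unfolding is_inverse_def by (metis blinfun_apply_blinfun_compose blinfun_apply_id_blinfun id_apply)
  finally show "R f = R' f" .
qed

lemma cesaro_scaleC: "cesaro (c *\<^sub>C f) = c *\<^sub>C cesaro f"
  by transfer (rule cesaro_map_scaleC)

lemma cesaro_abs_L2:
  assumes "square_integrable f"
  shows "cesaro (abs_L2 f) = abs_L2 (cesaro_fun f)"
  by (simp add: cesaro.rep_eq cesaro_map.abs_eq assms)

lemma abs_L2_eq_iff: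
  assumes "square_integrable f" "square_integrable g"
  shows "abs_L2 f = abs_L2 g \<longleftrightarrow> (AE x in unit_ivl. f x = g x)"
  using Quotient_rel_abs[OF Quotient_L2, of f g] Quotient_rel[OF Quotient_L2, of f g] assms by auto

lemma rep_L2_abs_L2_AE:
  assumes "square_integrable f"
  shows "AE x in unit_ivl. rep_L2 (abs_L2 f) x = f x"
  using Quotient_rep_abs[OF Quotient_L2, of f] assms by auto

text \<open>\<^typ>\<open>'a \<Rightarrow>\<^sub>L 'b\<close> only records real linearity. For complex-linear \<open>T\<close> (such as
  \<^const>\<open>cesaro\<close>) this makes no difference here: an inverse of a complex-linear map is
  complex-linear.\<close>

definition spectrum :: "(L2 \<Rightarrow>\<^sub>L L2) \<Rightarrow> complex set"
  where "spectrum T = {z. \<nexists>R. is_inverse (cscale z - T) R}"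

text \<open>Only meaningful if \<open>T\<close> is invertible with bounded inverse.\<close>

definition op_inverse :: "(L2 \<Rightarrow>\<^sub>L L2) \<Rightarrow> L2 \<Rightarrow>\<^sub>L L2"
  where "op_inverse T = (THE R. is_inverse T R)"

end

theory Submission
  imports Defs
begin

text \<open>
  Put \<open>\<alpha> = 1 / \<lambda>\<close> and \<open>r x = x / (1 - x)\<close>. In the coordinate \<open>s = ln (r x)\<close>, and with
  \<open>f x * sqrt (x * (1 - x))\<close> in place of \<open>f x\<close>, the Cesaro operator \<open>C\<close> becomes convolution on the real
  line with \<open>exp (- s / 2)\<close> cut off to \<open>s > 0\<close>. Its resolvents are, up to multiples of the identity,
  convolutions with \<open>exp ((\<alpha> - 1 / 2) * s)\<close>, cut off to the half-line on which this function decays: to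
  \<open>s > 0\<close> if \<open>Re \<alpha> < 1 / 2\<close> and, with a minus sign, to \<open>s < 0\<close> if \<open>Re \<alpha> > 1 / 2\<close>. The first case is
  \<open>\<lambda>\<close> outside the closed disk and the second is \<open>\<lambda>\<close> inside the disk (\<open>Re_inverse_gt_half_iff\<close>), which
  is why the two formulas integrate from different ends.

  In the original coordinate, let \<open>K \<alpha>\<close> be the operator with kernel \<open>(r x / r t) powr \<alpha> / (x * (1 - t))\<close>
  on \<open>t < x\<close> if \<open>Re \<alpha> < 1 / 2\<close>, and with the negative of this kernel on \<open>x < t\<close> if \<open>Re \<alpha> > 1 / 2\<close>; in
  particular \<open>K 0 = C\<close>. The Schur test with the weight used for \<open>C\<close> bounds every \<open>K \<alpha>\<close>
  (\<open>schur_kernel_resolvent_kernel\<close>). Since \<open>dy / (y * (1 - y))\<close> is \<open>ds\<close>, composing two kernels amounts to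
  integrating an exponential over an interval (\<open>resolvent_kernel_compose\<close>), and Fubini's theorem
  (\<open>kernel_fun_compose_AE\<close>) turns the outcome into the identity
  \<open>(\<alpha> - \<beta>) * K \<alpha> * K \<beta> = K \<alpha> - K \<beta>\<close> (\<open>resolvent_identity\<close>), whichever sides the two kernels live on.
  Taking one parameter to be 0 shows that \<open>\<alpha> + \<alpha>\<^sup>2 * K \<alpha>\<close> is a two-sided inverse of \<open>1 / \<alpha> - C\<close>
  (\<open>is_inverse_resolvent\<close>). Splitting \<open>(r x / r t) powr \<alpha>\<close> into powers of \<open>x\<close>, \<open>1 - x\<close>, \<open>t\<close> and \<open>1 - t\<close>
  gives the stated formulas.
\<close>

section \<open>Integral operators passing the Schur test\<close>

text \<open>Fixing the weight of the Cesaro operator costs nothing here: the kernels of all its resolvents pass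
  the test with this one weight. The two integral bounds only see the open unit square.\<close>

definition schur_kernel :: "(real \<Rightarrow> real \<Rightarrow> complex) \<Rightarrow> bool"
  where "schur_kernel \<kappa> \<longleftrightarrow> case_prod \<kappa> \<in> borel_measurable (borel \<Otimes>\<^sub>M borel) \<and>
    (\<exists>A\<ge>0. (\<forall>x\<in>{0<..<1}. (\<integral>\<^sup>+t\<in>{0<..<1}. ennreal (cmod (\<kappa> x t) * cesaro_weight t) \<partial>lborel)
              \<le> ennreal (A * cesaro_weight x)) \<and>
           (\<forall>t\<in>{0<..<1}. (\<integral>\<^sup>+x\<in>{0<..<1}. ennreal (cmod (\<kappa> x t) * cesaro_weight x) \<partial>lborel)
              \<le> ennreal (A * cesaro_weight t)))"

definition kernel_fun :: "(real \<Rightarrow> real \<Rightarrow> complex) \<Rightarrow> (real \<Rightarrow> complex) \<Rightarrow> real \<Rightarrow> complex"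
  where "kernel_fun \<kappa> f x = (\<integral>t. \<kappa> x t * f t \<partial>unit_ivl)"

lemma schur_kernel_measurable: "schur_kernel \<kappa> \<Longrightarrow> case_prod \<kappa> \<in> borel_measurable (borel \<Otimes>\<^sub>M borel)"
  by (simp add: schur_kernel_def)

lemma borel_measurable_unit_ivl: "f \<in> borel_measurable borel \<Longrightarrow> f \<in> borel_measurable unit_ivl"
  for f :: "real \<Rightarrow> complex"
  by (intro measurable_restrict_space1 measurable_completion) simp

lemma kernel_slice_measurable:
  fixes \<kappa> :: "real \<Rightarrow> real \<Rightarrow> complex"
  assumes [measurable]: "case_prod \<kappa> \<in> borel_measurable (borel \<Otimes>\<^sub>M borel)"
  shows "\<kappa> x \<in> borel_measurable unit_ivl"
proof -
  show ?thesis
    by (rule borel_measurable_unit_ivl) measurable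
qed

lemma kernel_fun_bounded:
  assumes "schur_kernel \<kappa>"
  obtains A where "0 \<le> A"
    and "\<And>f. square_integrable f \<Longrightarrow> square_integrable (kernel_fun \<kappa> f)"
    and "\<And>f. square_integrable f \<Longrightarrow>
      (\<integral>x. (cmod (kernel_fun \<kappa> f x))\<^sup>2 \<partial>unit_ivl) \<le> A\<^sup>2 * (\<integral>x. (cmod (f x))\<^sup>2 \<partial>unit_ivl)"
    and "\<And>f. square_integrable f \<Longrightarrow> AE x in unit_ivl. integrable unit_ivl (\<lambda>t. \<kappa> x t * f t)"
proof -
  from assms obtain A where k: "case_prod \<kappa> \<in> borel_measurable (borel \<Otimes>\<^sub>M borel)" and A: "0 \<le> A"
    and 1: "\<And>x. x \<in> {0<..<1} \<Longrightarrow>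
      (\<integral>\<^sup>+t\<in>{0<..<1}. ennreal (cmod (\<kappa> x t) * cesaro_weight t) \<partial>lborel) \<le> ennreal (A * cesaro_weight x)"
    and 2: "\<And>t. t \<in> {0<..<1} \<Longrightarrow>
      (\<integral>\<^sup>+x\<in>{0<..<1}. ennreal (cmod (\<kappa> x t) * cesaro_weight x) \<partial>lborel) \<le> ennreal (A * cesaro_weight t)"
    unfolding schur_kernel_def by blast
  have w: "cesaro_weight \<in> borel_measurable borel"
    unfolding cesaro_weight_def by measurable
  have w0: "0 < cesaro_weight t" if "t \<in> {0<..<1}" for t
    using that by (simp add: cesaro_weight_def)
  note schur = schur_test[OF k w w0 A A 1 2]
  show thesis
  proof
    fix f assume f: "square_integrable f"
    show "square_integrable (kernel_fun \<kappa> f)"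
      using schur(1)[OF _ _ _ f] unfolding kernel_fun_def by blast
    show "(\<integral>x. (cmod (kernel_fun \<kappa> f x))\<^sup>2 \<partial>unit_ivl) \<le> A\<^sup>2 * (\<integral>x. (cmod (f x))\<^sup>2 \<partial>unit_ivl)"
      using schur(2)[OF _ _ _ f] unfolding kernel_fun_def power2_eq_square[of A] by blast
    show "AE x in unit_ivl. integrable unit_ivl (\<lambda>t. \<kappa> x t * f t)"
      using schur(3)[OF _ _ _ f] by blast
  qed (fact A)
qed

lemma square_integrable_kernel_fun:
  "schur_kernel \<kappa> \<Longrightarrow> square_integrable f \<Longrightarrow> square_integrable (kernel_fun \<kappa> f)"
  using kernel_fun_bounded by metis

lemma kernel_integrable_AE:
  "schur_kernel \<kappa> \<Longrightarrow> square_integrable f \<Longrightarrow> AE x in unit_ivl. integrable unit_ivl (\<lambda>t. \<kappa> x t * f t)"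
  by (rule kernel_fun_bounded) blast

text \<open>Equality holds at every point, so the choice of representative of a class is immaterial.\<close>

lemma kernel_fun_cong_AE:
  assumes k: "case_prod \<kappa> \<in> borel_measurable (borel \<Otimes>\<^sub>M borel)"
    and f: "square_integrable f" and g: "square_integrable g"
    and fg: "AE x in unit_ivl. f x = g x"
  shows "kernel_fun \<kappa> f = kernel_fun \<kappa> g"
proof
  fix x
  have "AE t in unit_ivl. \<kappa> x t * f t = \<kappa> x t * g t"
    using fg by eventually_elim simp
  then show "kernel_fun \<kappa> f x = kernel_fun \<kappa> g x"
    unfolding kernel_fun_def using f g kernel_slice_measurable[OF k]
    by (intro integral_cong_AE borel_measurable_times) (auto simp: square_integrable_def)
qed

lemma kernel_fun_cmult: "kernel_fun \<kappa> (\<lambda>t. c * f t) x = c * kernel_fun \<kappa> f x"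
proof -
  have "kernel_fun \<kappa> (\<lambda>t. c * f t) x = (\<integral>t. c * (\<kappa> x t * f t) \<partial>unit_ivl)"
    unfolding kernel_fun_def by (simp add: mult.left_commute)
  also have "\<dots> = c * kernel_fun \<kappa> f x"
    unfolding kernel_fun_def by (rule integral_mult_right_zero)
  finally show ?thesis .
qed

lemma kernel_fun_add_AE:
  assumes "schur_kernel \<kappa>" "square_integrable f" "square_integrable g"
  shows "AE x in unit_ivl. kernel_fun \<kappa> (\<lambda>t. f t + g t) x = kernel_fun \<kappa> f x + kernel_fun \<kappa> g x"
  using kernel_integrable_AE[OF assms(1,2)] kernel_integrable_AE[OF assms(1,3)]
  by eventually_elim (simp add: kernel_fun_def distrib_left)

lemma L2_cases:
  obtains f where "F = abs_L2 f" "square_integrable f"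
  using Quotient_abs_rep[OF Quotient_L2, of F] Quotient_rep_reflp[OF Quotient_L2, of F] by metis

lemma abs_L2_add:
  "square_integrable f \<Longrightarrow> square_integrable g \<Longrightarrow> abs_L2 f + abs_L2 g = abs_L2 (\<lambda>x. f x + g x)"
  by (simp add: plus_L2.abs_eq)

lemma abs_L2_scaleC: "square_integrable f \<Longrightarrow> c *\<^sub>C abs_L2 f = abs_L2 (\<lambda>x. c * f x)"
  by (simp add: scaleC_L2.abs_eq)

lemma scaleR_L2_conv_scaleC: "r *\<^sub>R F = complex_of_real r *\<^sub>C F"
  by (rule L2_cases[of F]) (simp add: scaleC_L2.abs_eq scaleR_L2.abs_eq scaleR_conv_of_real)

text \<open>A bounded operator on \<^typ>\<open>L2\<close> when \<open>\<kappa>\<close> is a Schur kernel; if the map inside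
  \<^const>\<open>Blinfun\<close> is not bounded linear, nothing is known about the result.\<close>

definition integral_op :: "(real \<Rightarrow> real \<Rightarrow> complex) \<Rightarrow> L2 \<Rightarrow>\<^sub>L L2"
  where "integral_op \<kappa> = Blinfun (\<lambda>F. abs_L2 (kernel_fun \<kappa> (rep_L2 F)))"

lemma integral_op_abs_L2:
  assumes k: "schur_kernel \<kappa>" and f: "square_integrable f"
  shows "integral_op \<kappa> (abs_L2 f) = abs_L2 (kernel_fun \<kappa> f)"
proof -
  define T where "T F = abs_L2 (kernel_fun \<kappa> (rep_L2 F))" for F
  have T: "T (abs_L2 h) = abs_L2 (kernel_fun \<kappa> h)" if h: "square_integrable h" for h
  proof -
    have "square_integrable (rep_L2 (abs_L2 h))"
      using Quotient_rep_reflp[OF Quotient_L2] by blast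
    then have "kernel_fun \<kappa> (rep_L2 (abs_L2 h)) = kernel_fun \<kappa> h"
      by (intro kernel_fun_cong_AE schur_kernel_measurable[OF k] h rep_L2_abs_L2_AE)
    then show ?thesis by (simp add: T_def)
  qed
  note sq = square_integrable_kernel_fun[OF k]
  obtain A where A: "0 \<le> A" "\<And>f. square_integrable f \<Longrightarrow> square_integrable (kernel_fun \<kappa> f)" "\<And>f. square_integrable f \<Longrightarrow>
      (\<integral>x. (cmod (kernel_fun \<kappa> f x))\<^sup>2 \<partial>unit_ivl) \<le> A\<^sup>2 * (\<integral>x. (cmod (f x))\<^sup>2 \<partial>unit_ivl)"
    "\<And>f. square_integrable f \<Longrightarrow> AE x in unit_ivl. integrable unit_ivl (\<lambda>t. \<kappa> x t * f t)"
    using k by (rule kernel_fun_bounded) blast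
  have "bounded_linear T"
  proof (rule bounded_linear_intro)
    fix F G :: L2 and r :: real
    obtain f g where F: "F = abs_L2 f" "square_integrable f" and G: "G = abs_L2 g" "square_integrable g"
      using L2_cases by metis
    show "T (F + G) = T F + T G"
      using F G kernel_fun_add_AE[OF k F(2) G(2)]
      by (simp add: abs_L2_add T sq square_integrable_add abs_L2_eq_iff)
    show "T (r *\<^sub>R F) = r *\<^sub>R T F"
      using F by (simp add: scaleR_L2_conv_scaleC abs_L2_scaleC T sq square_integrable_cmult
          kernel_fun_cmult[abs_def])
    have "(norm (T F))\<^sup>2 \<le> (norm F * A)\<^sup>2"
      using A(3)[OF F(2)] F by (simp add: T norm_L2_squared_abs sq power_mult_distrib mult.commute)
    then show "norm (T F) \<le> norm F * A"
      by (rule power2_le_imp_le) (simp add: A)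
  qed
  then have "blinfun_apply (integral_op \<kappa>) = T"
    unfolding integral_op_def T_def by (rule bounded_linear_Blinfun_apply)
  with T[OF f] show ?thesis by simp
qed

lemma integral_op_scaleC:
  assumes k: "schur_kernel \<kappa>"
  shows "integral_op \<kappa> (c *\<^sub>C F) = c *\<^sub>C integral_op \<kappa> F"
  by (rule L2_cases[of F])
    (simp add: k abs_L2_scaleC integral_op_abs_L2 square_integrable_cmult
      square_integrable_kernel_fun kernel_fun_cmult[abs_def])

lemma unit_ivl_integral_lborel:
  fixes h :: "real \<Rightarrow> 'a::{banach, second_countable_topology}"
  assumes "h \<in> borel_measurable borel"
  shows "(\<integral>t. h t \<partial>unit_ivl) = (\<integral>t. indicator {0<..<1} t *\<^sub>R h t \<partial>lborel)"
    and "integrable unit_ivl h \<longleftrightarrow> integrable lborel (\<lambda>t. indicator {0<..<1} t *\<^sub>R h t)"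
proof -
  note [measurable] = assms
  have "(\<integral>t. h t \<partial>unit_ivl) = (\<integral>t. indicator {0<..<1} t *\<^sub>R h t \<partial>lebesgue)"
    by (simp add: integral_restrict_space)
  also have "\<dots> = (\<integral>t. indicator {0<..<1} t *\<^sub>R h t \<partial>lborel)"
    by (rule integral_completion) measurable
  finally show "(\<integral>t. h t \<partial>unit_ivl) = (\<integral>t. indicator {0<..<1} t *\<^sub>R h t \<partial>lborel)" .
  have "integrable unit_ivl h \<longleftrightarrow> integrable lebesgue (\<lambda>t. indicator {0<..<1} t *\<^sub>R h t)"
    by (simp add: integrable_restrict_space)
  also have "\<dots> \<longleftrightarrow> integrable lborel (\<lambda>t. indicator {0<..<1} t *\<^sub>R h t)"
    by (rule integrable_completion) measurable
  finally show "integrable unit_ivl h \<longleftrightarrow> integrable lborel (\<lambda>t. indicator {0<..<1} t *\<^sub>R h t)" .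
qed

text \<open>Fubini's theorem. Absolute convergence for almost every \<open>x\<close> is free: \<open>\<bar>\<kappa>1\<bar>\<close>, \<open>\<bar>\<kappa>2\<bar>\<close> and
  \<open>\<bar>f\<bar>\<close> satisfy the same hypotheses, so \<open>H = \<integral> \<bar>\<kappa>2\<bar> \<bar>f\<bar>\<close> is square integrable, and then
  \<open>\<bar>\<kappa>1 x\<bar> * H\<close> is integrable for almost every \<open>x\<close>. The composed kernel is left unspecified on the
  diagonal, where the resolvent kernels below jump.\<close>

lemma kernel_fun_compose_AE:
  assumes k1: "schur_kernel \<kappa>1" and k2: "schur_kernel \<kappa>2"
    and f: "square_integrable f"
    and k3: "\<And>x t. x \<in> {0<..<1} \<Longrightarrow> t \<in> {0<..<1} \<Longrightarrow> x \<noteq> t \<Longrightarrow>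
      (\<integral>y. \<kappa>1 x y * \<kappa>2 y t \<partial>unit_ivl) = \<kappa>3 x t"
    and k3m: "case_prod \<kappa>3 \<in> borel_measurable (borel \<Otimes>\<^sub>M borel)"
  shows "AE x in unit_ivl. kernel_fun \<kappa>1 (kernel_fun \<kappa>2 f) x = kernel_fun \<kappa>3 f x"
proof -
  let ?S = "{0<..<1::real}"
  note [measurable] = schur_kernel_measurable[OF k1] schur_kernel_measurable[OF k2]
    k3m
  \<comment> \<open>Fubini's theorem is applied on \<open>lborel\<close>, so \<open>f\<close> is first replaced by a Borel function.\<close>
  have "(\<lambda>x. indicator ?S x *\<^sub>R f x) \<in> borel_measurable lebesgue"
    using f by (simp add: borel_measurable_restrict_space_iff square_integrable_def)
  then obtain g where g [measurable]: "g \<in> borel_measurable borel"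
      and "AE x in lebesgue. indicator ?S x *\<^sub>R f x = g x"
    by (rule lebesgue_borel_AE)
  then have fg: "AE x in unit_ivl. f x = g x"
    by (subst AE_restrict_space_iff) (auto elim!: eventually_mono)
  note [measurable] = square_integrable_measurable[OF f]
  have gm [measurable]: "g \<in> borel_measurable unit_ivl"
    by (rule borel_measurable_unit_ivl) simp
  have "integrable unit_ivl (\<lambda>x. (cmod (g x))\<^sup>2)"
  proof (subst integrable_cong_AE)
    show "AE x in unit_ivl. (cmod (g x))\<^sup>2 = (cmod (f x))\<^sup>2"
      using fg by eventually_elim simp
  qed (use f in \<open>auto simp: square_integrable_def\<close>)
  then have sq_g: "square_integrable g"
    by (simp add: square_integrable_def)
  define g' where "g' t = indicator ?S t *\<^sub>R g t" for t
  have [measurable]: "g' \<in> borel_measurable borel"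
    unfolding g'_def by measurable
  have K2: "kernel_fun \<kappa>2 g y = (\<integral>t. \<kappa>2 y t * g' t \<partial>lborel)" for y
    unfolding kernel_fun_def by (subst unit_ivl_integral_lborel) (auto simp: g'_def)
  define a where "a \<kappa> x t = complex_of_real (cmod (\<kappa> x t))" for \<kappa> :: "real \<Rightarrow> real \<Rightarrow> complex" and x t
  have a: "schur_kernel (a \<kappa>)" if "schur_kernel \<kappa>" for \<kappa>
  proof -
    note [measurable] = schur_kernel_measurable[OF that]
    have "case_prod (a \<kappa>) \<in> borel_measurable (borel \<Otimes>\<^sub>M borel)"
      unfolding a_def by measurable
    then show ?thesis
      using that by (simp add: schur_kernel_def a_def)
  qed
  define H where "H y = (\<integral>t. cmod (\<kappa>2 y t * g' t) \<partial>lborel)" for y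
  have [measurable]: "H \<in> borel_measurable borel"
    unfolding H_def by measurable
  have "square_integrable (\<lambda>t. complex_of_real (cmod (g t)))"
    using sq_g by (simp add: square_integrable_def)
  then have "square_integrable (kernel_fun (a \<kappa>2) (\<lambda>t. complex_of_real (cmod (g t))))"
    by (intro square_integrable_kernel_fun a k2)
  also have "kernel_fun (a \<kappa>2) (\<lambda>t. complex_of_real (cmod (g t))) = (\<lambda>y. complex_of_real (H y))"
  proof
    fix y
    have "kernel_fun (a \<kappa>2) (\<lambda>t. complex_of_real (cmod (g t))) y
        = (\<integral>t. complex_of_real (cmod (\<kappa>2 y t * g' t)) \<partial>lborel)"
      unfolding kernel_fun_def a_def
      by (subst unit_ivl_integral_lborel) (auto simp: g'_def norm_mult indicator_def intro!: Bochner_Integration.integral_cong)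
    then show "kernel_fun (a \<kappa>2) (\<lambda>t. complex_of_real (cmod (g t))) y = complex_of_real (H y)"
      by (simp add: H_def)
  qed
  finally have int1: "AE x in unit_ivl. integrable unit_ivl (\<lambda>y. a \<kappa>1 x y * complex_of_real (H y))"
    by (intro kernel_integrable_AE a k1)
  have "AE y in unit_ivl. integrable unit_ivl (\<lambda>t. \<kappa>2 y t * g t)"
    by (intro kernel_integrable_AE k2 sq_g)
  then have int2: "AE y in lborel. y \<in> ?S \<longrightarrow> integrable lborel (\<lambda>t. \<kappa>2 y t * g' t)"
  proof -
    have "integrable lborel (\<lambda>t. \<kappa>2 y t * g' t)" if "integrable unit_ivl (\<lambda>t. \<kappa>2 y t * g t)" for y
      using that by (subst (asm) unit_ivl_integral_lborel(2)) (simp_all add: g'_def)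
    then show ?thesis
      using \<open>AE y in unit_ivl. integrable unit_ivl (\<lambda>t. \<kappa>2 y t * g t)\<close>
      by (simp add: AE_restrict_space_iff AE_completion_iff) (auto elim!: eventually_mono)
  qed
  have "AE x in unit_ivl. x \<in> ?S"
    by (intro AE_I2) simp
  with int1 show ?thesis
  proof eventually_elim
    case (elim x)
    define G where "G y t = indicator ?S y *\<^sub>R (\<kappa>1 x y * (\<kappa>2 y t * g' t))" for y t
    have Gm [measurable]: "case_prod G \<in> borel_measurable (borel \<Otimes>\<^sub>M borel)"
      unfolding G_def by measurable
    have "integrable lborel (\<lambda>y. indicator ?S y *\<^sub>R (a \<kappa>1 x y * complex_of_real (H y)))"
      using elim(1) by (subst (asm) unit_ivl_integral_lborel(2)) (simp_all add: a_def)
    then have "integrable lborel (\<lambda>y. cmod (indicator ?S y *\<^sub>R (a \<kappa>1 x y * complex_of_real (H y))))"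
      by (rule integrable_norm)
    also have "(\<lambda>y. cmod (indicator ?S y *\<^sub>R (a \<kappa>1 x y * complex_of_real (H y))))
        = (\<lambda>y. \<integral>t. cmod (G y t) \<partial>lborel)"
      by (auto simp: G_def a_def H_def norm_mult indicator_def abs_of_nonneg)
    finally have "integrable lborel (\<lambda>y. \<integral>t. norm (case (y, t) of (y, t) \<Rightarrow> G y t) \<partial>lborel)"
      by simp
    moreover have "AE y in lborel. integrable lborel (\<lambda>t. case (y, t) of (y, t) \<Rightarrow> G y t)"
      using int2 by eventually_elim (auto simp: G_def indicator_def)
    ultimately have "integrable (lborel \<Otimes>\<^sub>M lborel) (case_prod G)"
      by (intro lborel_pair.Fubini_integrable) (simp_all add: Gm)
    then have fub: "(\<integral>t. (\<integral>y. G y t \<partial>lborel) \<partial>lborel) = (\<integral>y. (\<integral>t. G y t \<partial>lborel) \<partial>lborel)"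
      by (rule lborel_pair.Fubini_integral)
    have inner: "(\<integral>t. G y t \<partial>lborel)
        = indicator ?S y *\<^sub>R (\<kappa>1 x y * (\<integral>t. \<kappa>2 y t * g' t \<partial>lborel))" for y
      by (cases "y \<in> ?S") (simp_all add: G_def)
    have "kernel_fun \<kappa>1 (kernel_fun \<kappa>2 f) x = kernel_fun \<kappa>1 (kernel_fun \<kappa>2 g) x"
      by (simp add: kernel_fun_cong_AE[OF schur_kernel_measurable[OF k2] f sq_g fg])
    also have "\<dots> = (\<integral>y. (\<integral>t. G y t \<partial>lborel) \<partial>lborel)"
      unfolding kernel_fun_def[of \<kappa>1]
      by (subst unit_ivl_integral_lborel) (auto simp: K2 inner)
    also have "\<dots> = (\<integral>t. (\<integral>y. G y t \<partial>lborel) \<partial>lborel)"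
      by (rule fub[symmetric])
    also have "\<dots> = (\<integral>t. \<kappa>3 x t * g' t \<partial>lborel)"
    proof (rule integral_cong_AE)
      show "AE t in lborel. (\<integral>y. G y t \<partial>lborel) = \<kappa>3 x t * g' t"
        using AE_lborel_singleton[of x]
      proof eventually_elim
        case (elim t)
        have "(\<integral>y. G y t \<partial>lborel) = (\<integral>y. indicator ?S y *\<^sub>R (\<kappa>1 x y * \<kappa>2 y t) * g' t \<partial>lborel)"
          by (simp add: G_def mult.assoc)
        also have "\<dots> = (\<integral>y. indicator ?S y *\<^sub>R (\<kappa>1 x y * \<kappa>2 y t) \<partial>lborel) * g' t"
          by (rule integral_mult_left_zero)
        also have "(\<integral>y. indicator ?S y *\<^sub>R (\<kappa>1 x y * \<kappa>2 y t) \<partial>lborel)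
            = (\<integral>y. \<kappa>1 x y * \<kappa>2 y t \<partial>unit_ivl)"
          by (subst unit_ivl_integral_lborel) auto
        also have "\<dots> * g' t = \<kappa>3 x t * g' t"
          using k3[of x t] elim \<open>x \<in> ?S\<close> by (cases "t \<in> ?S") (auto simp: g'_def)
        finally show ?case .
      qed
    qed measurable
    also have "\<dots> = kernel_fun \<kappa>3 g x"
      unfolding kernel_fun_def by (subst unit_ivl_integral_lborel) (auto simp: g'_def)
    also have "\<dots> = kernel_fun \<kappa>3 f x"
      by (simp add: kernel_fun_cong_AE[OF k3m f sq_g fg])
    finally show ?case .
  qed
qed

section \<open>Complex powers of the odds\<close>

text \<open>This coordinate maps the unit interval onto the real line and turns the measure
  \<open>dx / (x * (1 - x))\<close> into Lebesgue measure.\<close>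

definition logit :: "real \<Rightarrow> real"
  where "logit x = ln x - ln (1 - x)"

lemma has_real_derivative_logit:
  assumes "0 < x" "x < 1"
  shows "(logit has_real_derivative 1 / (x * (1 - x))) (at x)"
  unfolding logit_def using assms
  by (auto intro!: derivative_eq_intros simp: field_simps)

lemma borel_measurable_logit [measurable]: "logit \<in> borel_measurable borel"
  unfolding logit_def by measurable

lemma logit_at_right_0: "filterlim logit at_bot (at_right 0)"
  unfolding logit_def by real_asymp

lemma logit_at_left_1: "filterlim logit at_top (at_left 1)"
  unfolding logit_def by real_asymp

text \<open>The complex power \<open>(y / (1 - y)) powr \<gamma>\<close>. The value 0 at the endpoints is the limit there as soon
  as the power decays: at 0 for \<open>Re \<gamma> > 0\<close>, at 1 for \<open>Re \<gamma> < 0\<close>. It lets one formula cover integrals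
  over \<open>{l<..<u}\<close> with or without an end of the unit interval.\<close>

definition odds_power :: "complex \<Rightarrow> real \<Rightarrow> complex"
  where "odds_power \<gamma> y = (if 0 < y \<and> y < 1 then exp (\<gamma> * of_real (logit y)) else 0)"

lemma norm_odds_power: "0 < y \<Longrightarrow> y < 1 \<Longrightarrow> cmod (odds_power \<gamma> y) = exp (Re \<gamma> * logit y)"
  by (simp add: odds_power_def)

lemma odds_power_eq: "0 < y \<Longrightarrow> y < 1 \<Longrightarrow> odds_power \<gamma> y = exp (\<gamma> * of_real (logit y))"
  by (simp add: odds_power_def)

lemma has_vector_derivative_odds_power:
  assumes "0 < y" "y < 1"
  shows "(odds_power \<gamma> has_vector_derivative \<gamma> * (odds_power \<gamma> y / of_real (y * (1 - y)))) (at y)"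
proof -
  have "((\<lambda>y. of_real (logit y)) has_vector_derivative complex_of_real (1 / (y * (1 - y)))) (at y)"
    by (intro has_vector_derivative_of_real has_real_derivative_logit assms)
  then have "((\<lambda>y. \<gamma> * of_real (logit y)) has_vector_derivative \<gamma> * complex_of_real (1 / (y * (1 - y)))) (at y)"
    by (intro has_vector_derivative_mult_right)
  from field_vector_diff_chain_at[OF this DERIV_exp]
  have "((\<lambda>y. exp (\<gamma> * of_real (logit y))) has_vector_derivative
      \<gamma> * (odds_power \<gamma> y / of_real (y * (1 - y)))) (at y)"
    using assms by (simp add: o_def odds_power_eq field_simps)
  then show ?thesis
    by (rule has_vector_derivative_transform_within_open[where S = "{0<..<1}"])
      (use assms in \<open>auto simp: odds_power_eq\<close>)
qed

lemma isCont_odds_power: "0 < y \<Longrightarrow> y < 1 \<Longrightarrow> isCont (odds_power \<gamma>) y"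
  by (rule has_vector_derivative_continuous has_vector_derivative_odds_power)+

lemma odds_power_at_right:
  assumes "0 \<le> l" "l < 1" "l = 0 \<Longrightarrow> 0 < Re \<gamma>"
  shows "(odds_power \<gamma> \<longlongrightarrow> odds_power \<gamma> l) (at_right l)"
proof (cases "l = 0")
  case True
  have "((\<lambda>y. exp (Re \<gamma> * logit y)) \<longlongrightarrow> 0) (at_right 0)"
    using assms True
    by (intro filterlim_compose[OF exp_at_bot] filterlim_tendsto_pos_mult_at_bot[OF tendsto_const]
        logit_at_right_0) auto
  moreover have "\<forall>\<^sub>F y in at_right 0. exp (Re \<gamma> * logit y) = cmod (odds_power \<gamma> y)"
    using eventually_at_right_less eventually_at_right_real[of 0 1]
    by (auto elim!: eventually_mono simp: norm_odds_power)
  ultimately have "((\<lambda>y. cmod (odds_power \<gamma> y)) \<longlongrightarrow> 0) (at_right 0)"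
    by (rule Lim_transform_eventually)
  then show ?thesis
    using True by (simp add: odds_power_def[of _ 0] tendsto_norm_zero_iff)
next
  case False
  then show ?thesis
    using isCont_odds_power[of l \<gamma>] assms by (simp add: isCont_def filterlim_at_split)
qed

lemma odds_power_at_left:
  assumes "0 < u" "u \<le> 1" "u = 1 \<Longrightarrow> Re \<gamma> < 0"
  shows "(odds_power \<gamma> \<longlongrightarrow> odds_power \<gamma> u) (at_left u)"
proof (cases "u = 1")
  case True
  have "((\<lambda>y. exp (Re \<gamma> * logit y)) \<longlongrightarrow> 0) (at_left 1)"
    using assms True
    by (intro filterlim_compose[OF exp_at_bot] filterlim_tendsto_neg_mult_at_bot[OF tendsto_const]
        logit_at_left_1) auto
  moreover have "\<forall>\<^sub>F y in at_left 1. exp (Re \<gamma> * logit y) = cmod (odds_power \<gamma> y)"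
    using eventually_at_left_real[of 0 "1::real"]
    by (auto elim!: eventually_mono simp: norm_odds_power)
  ultimately have "((\<lambda>y. cmod (odds_power \<gamma> y)) \<longlongrightarrow> 0) (at_left 1)"
    by (rule Lim_transform_eventually)
  then show ?thesis
    using True by (simp add: odds_power_def[of _ 1] tendsto_norm_zero_iff)
next
  case False
  then show ?thesis
    using isCont_odds_power[of u \<gamma>] assms by (simp add: isCont_def filterlim_at_split)
qed

text \<open>The modulus of the power is the power with exponent \<open>Re \<gamma>\<close>, whose primitive with respect to
  \<open>dy / (y * (1 - y))\<close> is itself divided by \<open>Re \<gamma>\<close>. This gives both the Schur bounds of the resolvent
  kernels and the integrability behind their composition.\<close>

lemma nn_integral_odds_power:
  assumes "0 \<le> l" "l < u" "u \<le> 1"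
    and c: "Re \<gamma> \<noteq> 0" and l: "l = 0 \<Longrightarrow> 0 < Re \<gamma>" and u: "u = 1 \<Longrightarrow> Re \<gamma> < 0"
  shows "(\<integral>\<^sup>+y\<in>{l<..<u}. ennreal (cmod (odds_power \<gamma> y / of_real (y * (1 - y)))) \<partial>lborel)
    = ennreal ((cmod (odds_power \<gamma> u) - cmod (odds_power \<gamma> l)) / Re \<gamma>)"
proof -
  define f where "f y = exp (Re \<gamma> * logit y) * (1 / (y * (1 - y)))" for y
  define F where "F y = cmod (odds_power \<gamma> y) / Re \<gamma>" for y
  have "(\<integral>\<^sup>+y\<in>{l<..<u}. ennreal (cmod (odds_power \<gamma> y / of_real (y * (1 - y)))) \<partial>lborel)
      = (\<integral>\<^sup>+y\<in>{l<..<u}. ennreal (f y) \<partial>lborel)"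
    using assms by (intro nn_integral_cong)
      (auto simp: indicator_def f_def norm_divide norm_mult norm_odds_power simp flip: of_real_diff)
  also have "\<dots> = ennreal (F u - F l)"
  proof (rule nn_integral_FTC_Ioo[OF assms(2), of F])
    fix y assume "l < y" "y < u"
    then have y: "0 < y" "y < 1" using assms by auto
    have "((\<lambda>y. exp (Re \<gamma> * logit y) / Re \<gamma>) has_real_derivative
        exp (Re \<gamma> * logit y) * (Re \<gamma> * (1 / (y * (1 - y)))) / Re \<gamma>) (at y)"
      by (intro DERIV_cdivide DERIV_fun_exp DERIV_cmult has_real_derivative_logit y)
    also have "exp (Re \<gamma> * logit y) * (Re \<gamma> * (1 / (y * (1 - y)))) / Re \<gamma> = f y"
      using c by (simp add: f_def)
    finally show "(F has_real_derivative f y) (at y)"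
      by (rule has_field_derivative_transform_within_open[where S = "{0<..<1}"])
        (use y in \<open>auto simp: F_def norm_odds_power\<close>)
    show "isCont f y" unfolding f_def
      using y DERIV_isCont[OF has_real_derivative_logit[OF y]] by (auto intro!: continuous_intros)
    show "0 \<le> f y" using y by (simp add: f_def)
  next
    show "(F \<longlongrightarrow> F l) (at_right l)" "(F \<longlongrightarrow> F u) (at_left u)"
      unfolding F_def using assms
      by (auto intro!: tendsto_intros odds_power_at_right odds_power_at_left)
  qed
  finally show ?thesis by (simp add: F_def diff_divide_distrib)
qed

lemma borel_measurable_odds_power [measurable]: "odds_power \<gamma> \<in> borel_measurable borel"
  unfolding odds_power_def by measurable

text \<open>All composition integrals of resolvent kernels are of this form. A purely imaginary \<open>\<gamma>\<close> is allowed;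
  the interval is then bounded away from 0 and 1, so that integrability follows from continuity.\<close>

lemma integral_odds_power:
  assumes "0 \<le> l" "l < u" "u \<le> 1"
    and c: "\<gamma> \<noteq> 0" and l: "l = 0 \<Longrightarrow> 0 < Re \<gamma>" and u: "u = 1 \<Longrightarrow> Re \<gamma> < 0"
  shows "(LBINT y:{l<..<u}. odds_power \<gamma> y / of_real (y * (1 - y)))
    = (odds_power \<gamma> u - odds_power \<gamma> l) / \<gamma>"
proof -
  let ?f = "\<lambda>y. odds_power \<gamma> y / complex_of_real (y * (1 - y))"
  have cont: "isCont ?f y" if "0 < y" "y < 1" for y
    using that by (auto intro!: continuous_intros isCont_odds_power)
  have int: "set_integrable lborel {l<..<u} ?f"
  proof (cases "Re \<gamma> = 0")
    case True
    have "set_integrable lborel {l..u} ?f"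
      using assms True by (intro borel_integrable_atLeastAtMost' continuous_at_imp_continuous_on ballI cont) force+
    then show ?thesis
      by (rule set_integrable_subset) auto
  next
    case False
    show ?thesis unfolding set_integrable_def
    proof (rule integrableI_bounded)
      have "(\<integral>\<^sup>+y. ennreal (norm (indicator {l<..<u} y *\<^sub>R ?f y)) \<partial>lborel)
          = (\<integral>\<^sup>+y\<in>{l<..<u}. ennreal (cmod (?f y)) \<partial>lborel)"
        by (intro nn_integral_cong) (auto simp: indicator_def)
      then show "(\<integral>\<^sup>+y. ennreal (norm (indicator {l<..<u} y *\<^sub>R ?f y)) \<partial>lborel) < \<infinity>"
        by (simp only: nn_integral_odds_power[OF assms(1-3) False l u]) simp
    qed measurable
  qed
  have "(LBINT y=ereal l..ereal u. ?f y) = odds_power \<gamma> u / \<gamma> - odds_power \<gamma> l / \<gamma>"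
  proof (rule interval_integral_FTC_integrable)
    fix y assume "ereal l < ereal y" "ereal y < ereal u"
    then have y: "0 < y" "y < 1" using assms by auto
    have "((\<lambda>y. odds_power \<gamma> y / \<gamma>) has_vector_derivative \<gamma> * ?f y / \<gamma>) (at y)"
      by (intro has_vector_derivative_divide has_vector_derivative_odds_power y)
    then show "((\<lambda>y. odds_power \<gamma> y / \<gamma>) has_vector_derivative ?f y) (at y)"
      using c by simp
    show "isCont ?f y" using y by (rule cont)
  qed (use assms int in \<open>auto simp: ereal_tendsto_simps intro!: tendsto_intros odds_power_at_right odds_power_at_left\<close>)
  then show ?thesis
    using assms by (simp add: interval_lebesgue_integral_def diff_divide_distrib)
qed

section \<open>The resolvent kernels\<close>

text \<open>If \<open>(1 / \<alpha> - C) f = g\<close>, then \<open>x * (C f) x\<close> solves a first-order linear differential equation whose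
  homogeneous solutions are the multiples of \<open>(x / (1 - x)) powr \<alpha>\<close>. Integrating from 0 or from 1 gives
  two candidate solution operators, and the real part of \<open>\<alpha>\<close> decides which one is bounded; integrating
  from 1 costs a sign.\<close>

definition side_sign :: "complex \<Rightarrow> real \<Rightarrow> real \<Rightarrow> complex"
  where "side_sign \<alpha> x t = (if Re \<alpha> < 1 / 2 then (if t < x then 1 else 0) else (if x < t then -1 else 0))"

definition resolvent_kernel :: "complex \<Rightarrow> real \<Rightarrow> real \<Rightarrow> complex"
  where "resolvent_kernel \<alpha> x t =
    side_sign \<alpha> x t * (exp (\<alpha> * of_real (logit x - logit t)) / of_real (x * (1 - t)))"

lemma cesaro_kernel_eq_resolvent_kernel:
  "0 < t \<Longrightarrow> cesaro_kernel x t = resolvent_kernel 0 x t"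
  by (simp add: cesaro_kernel_def resolvent_kernel_def side_sign_def)

text \<open>Up to the factors \<open>1 / x\<close> and \<open>1 / (1 - x)\<close>, which occur in the kernels, the weight is a power of the
  odds with exponent \<open>1 / 2\<close>, respectively \<open>- 1 / 2\<close>. Weighted kernels are therefore again powers of the
  odds, and the number \<open>1 / 2\<close> is what singles out the critical line \<open>Re \<alpha> = 1 / 2\<close>.\<close>

lemma cesaro_weight_eq_exp_logit:
  assumes "0 < x" "x < 1"
  shows "cesaro_weight x = exp (logit x / 2) / x"
    and "cesaro_weight x = exp (- logit x / 2) / (1 - x)"
proof -
  have e: "exp (ln y / 2) = sqrt y" if "0 < y" for y :: real
    using that by (simp add: ln_sqrt[symmetric])
  have s: "sqrt x * sqrt x = x" "sqrt (1 - x) * sqrt (1 - x) = 1 - x" "0 < sqrt x" "0 < sqrt (1 - x)"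
    using assms by auto
  have "exp (logit x / 2) = sqrt x / sqrt (1 - x)"
    using assms by (simp add: logit_def diff_divide_distrib exp_diff e)
  moreover have "1 / (sqrt x * sqrt (1 - x)) = sqrt x / sqrt (1 - x) / (sqrt x * sqrt x)"
    using s(3,4) by (simp add: divide_simps)
  ultimately show "cesaro_weight x = exp (logit x / 2) / x"
    using assms by (simp add: cesaro_weight_def s(1))
  have "exp (- logit x / 2) = sqrt (1 - x) / sqrt x"
    using assms by (simp add: logit_def diff_divide_distrib exp_diff e)
  moreover have "1 / (sqrt x * sqrt (1 - x)) = sqrt (1 - x) / sqrt x / (sqrt (1 - x) * sqrt (1 - x))"
    using s(3,4) by (simp add: divide_simps)
  ultimately show "cesaro_weight x = exp (- logit x / 2) / (1 - x)"
    using assms by (simp add: cesaro_weight_def s(2))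
qed

lemma borel_measurable_resolvent_kernel:
  "case_prod (resolvent_kernel \<alpha>) \<in> borel_measurable (borel \<Otimes>\<^sub>M borel)"
  unfolding resolvent_kernel_def side_sign_def by measurable

lemma nn_integral_cmult_odds_power:
  assumes "0 \<le> C" "0 \<le> l" "l < u" "u \<le> 1"
    and "Re \<gamma> \<noteq> 0" "l = 0 \<Longrightarrow> 0 < Re \<gamma>" "u = 1 \<Longrightarrow> Re \<gamma> < 0"
    and eq: "\<And>y. 0 < y \<Longrightarrow> y < 1 \<Longrightarrow>
      f y = (if l < y \<and> y < u then C * cmod (odds_power \<gamma> y / of_real (y * (1 - y))) else 0)"
  shows "(\<integral>\<^sup>+y\<in>{0<..<1}. ennreal (f y) \<partial>lborel)
    = ennreal (C * ((cmod (odds_power \<gamma> u) - cmod (odds_power \<gamma> l)) / Re \<gamma>))"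
proof -
  have "(\<integral>\<^sup>+y\<in>{0<..<1}. ennreal (f y) \<partial>lborel)
      = (\<integral>\<^sup>+y. ennreal C * (ennreal (cmod (odds_power \<gamma> y / of_real (y * (1 - y)))) * indicator {l<..<u} y) \<partial>lborel)"
    using assms by (intro nn_integral_cong) (auto simp: indicator_def eq simp flip: ennreal_mult)
  also have "\<dots> = ennreal C * (\<integral>\<^sup>+y\<in>{l<..<u}. ennreal (cmod (odds_power \<gamma> y / of_real (y * (1 - y)))) \<partial>lborel)"
    by (rule nn_integral_cmult) measurable
  also have "\<dots> = ennreal (C * ((cmod (odds_power \<gamma> u) - cmod (odds_power \<gamma> l)) / Re \<gamma>))"
  proof -
    have "(\<integral>\<^sup>+y\<in>{l<..<u}. ennreal (cmod (odds_power \<gamma> y / of_real (y * (1 - y)))) \<partial>lborel)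
        = ennreal ((cmod (odds_power \<gamma> u) - cmod (odds_power \<gamma> l)) / Re \<gamma>)"
      by (intro nn_integral_odds_power assms(2-7))
    then show ?thesis
      using ennreal_mult'[OF assms(1)] by metis
  qed
  finally show ?thesis .
qed

text \<open>With \<open>c = 1 / 2 - Re \<alpha>\<close>, the weighted kernel is, up to a constant factor, the power of the odds with
  exponent \<open>c\<close> against \<open>dt / (t * (1 - t))\<close>, and with exponent \<open>- c\<close> against \<open>dx / (x * (1 - x))\<close>.
  In each case \<^const>\<open>side_sign\<close> keeps the side on which this power decays at the end of the unit
  interval, and both weighted integrals equal the weight divided by \<open>\<bar>c\<bar>\<close>.\<close>

lemma schur_kernel_resolvent_kernel:
  assumes "Re \<alpha> \<noteq> 1 / 2"
  shows "schur_kernel (resolvent_kernel \<alpha>)"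
proof -
  define c where "c = 1 / 2 - Re \<alpha>"
  have c: "c \<noteq> 0" "Re \<alpha> < 1 / 2 \<longleftrightarrow> 0 < c"
    using assms by (auto simp: c_def)
  have side_sign: "side_sign \<alpha> x t =
      (if (if 0 < c then t < x else x < t) then (if 0 < c then 1 else -1) else 0)" for x t
    unfolding side_sign_def c(2) by simp
  define A where "A = 1 / \<bar>c\<bar>"
  have weight_t: "cmod (resolvent_kernel \<alpha> x t) * cesaro_weight t =
      (if (if 0 < c then t < x else x < t) then
        exp (Re \<alpha> * logit x) / x * cmod (odds_power (of_real c) t / of_real (t * (1 - t))) else 0)"
    if "0 < x" "x < 1" "0 < t" "t < 1" for x t
  proof -
    have "exp (Re \<alpha> * (logit x - logit t)) * exp (logit t / 2)
        = exp (Re \<alpha> * logit x) * exp (c * logit t)"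
      unfolding exp_add[symmetric] c_def by (simp add: algebra_simps)
    then show ?thesis
      using that by (simp add: resolvent_kernel_def side_sign cesaro_weight_eq_exp_logit(1)
          norm_mult norm_divide norm_odds_power field_simps del: of_real_diff of_real_mult)
  qed
  have weight_x: "cmod (resolvent_kernel \<alpha> x t) * cesaro_weight x =
      (if (if 0 < c then t < x else x < t) then
        exp (- (Re \<alpha> * logit t)) / (1 - t) * cmod (odds_power (of_real (- c)) x / of_real (x * (1 - x))) else 0)"
    if "0 < x" "x < 1" "0 < t" "t < 1" for x t
  proof -
    have "exp (Re \<alpha> * (logit x - logit t)) * exp (- logit x / 2)
        = exp (- (Re \<alpha> * logit t)) * exp (- c * logit x)"
      unfolding exp_add[symmetric] c_def by (simp add: algebra_simps)
    then show ?thesis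
      using that by (simp add: resolvent_kernel_def side_sign cesaro_weight_eq_exp_logit(2)
          norm_mult norm_divide norm_odds_power field_simps del: of_real_diff of_real_mult)
  qed
  have out: "odds_power \<gamma> 0 = 0" "odds_power \<gamma> 1 = 0" for \<gamma>
    by (simp_all add: odds_power_def)
  have left: "(\<integral>\<^sup>+t\<in>{0<..<1}. ennreal (cmod (resolvent_kernel \<alpha> x t) * cesaro_weight t) \<partial>lborel)
      = ennreal (A * cesaro_weight x)" if x: "0 < x" "x < 1" for x
  proof -
    have e: "exp (Re \<alpha> * logit x) / x * cmod (odds_power (of_real c) x) = cesaro_weight x"
    proof -
      have "exp (Re \<alpha> * logit x) * exp (c * logit x) = exp (logit x / 2)"
        unfolding exp_add[symmetric] c_def by (simp add: algebra_simps)
      then show ?thesis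
        using x by (simp add: cesaro_weight_eq_exp_logit(1) norm_odds_power)
    qed
    define l u where "l = (if 0 < c then 0 else x)" and "u = (if 0 < c then x else 1)"
    have "(\<integral>\<^sup>+t\<in>{0<..<1}. ennreal (cmod (resolvent_kernel \<alpha> x t) * cesaro_weight t) \<partial>lborel)
        = ennreal (exp (Re \<alpha> * logit x) / x *
            ((cmod (odds_power (of_real c) u) - cmod (odds_power (of_real c) l)) / Re (of_real c)))"
      using x c by (intro nn_integral_cmult_odds_power) (auto simp: l_def u_def weight_t)
    also have "exp (Re \<alpha> * logit x) / x *
          ((cmod (odds_power (of_real c) u) - cmod (odds_power (of_real c) l)) / Re (of_real c))
        = A * (exp (Re \<alpha> * logit x) / x * cmod (odds_power (of_real c) x))"
      using c by (simp add: l_def u_def A_def out)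
    finally show ?thesis unfolding e .
  qed
  have right: "(\<integral>\<^sup>+x\<in>{0<..<1}. ennreal (cmod (resolvent_kernel \<alpha> x t) * cesaro_weight x) \<partial>lborel)
      = ennreal (A * cesaro_weight t)" if t: "0 < t" "t < 1" for t
  proof -
    have e: "exp (- (Re \<alpha> * logit t)) / (1 - t) * cmod (odds_power (of_real (- c)) t) = cesaro_weight t"
    proof -
      have "exp (- (Re \<alpha> * logit t)) * exp (- c * logit t) = exp (- logit t / 2)"
        unfolding exp_add[symmetric] c_def by (simp add: algebra_simps)
      then show ?thesis
        using t by (simp add: cesaro_weight_eq_exp_logit(2) norm_odds_power)
    qed
    define l u where "l = (if 0 < c then t else 0)" and "u = (if 0 < c then 1 else t)"
    have "(\<integral>\<^sup>+x\<in>{0<..<1}. ennreal (cmod (resolvent_kernel \<alpha> x t) * cesaro_weight x) \<partial>lborel)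
        = ennreal (exp (- (Re \<alpha> * logit t)) / (1 - t) *
            ((cmod (odds_power (of_real (- c)) u) - cmod (odds_power (of_real (- c)) l)) / Re (of_real (- c))))"
      using t c by (intro nn_integral_cmult_odds_power) (auto simp: l_def u_def weight_x)
    also have "exp (- (Re \<alpha> * logit t)) / (1 - t) *
          ((cmod (odds_power (of_real (- c)) u) - cmod (odds_power (of_real (- c)) l)) / Re (of_real (- c)))
        = A * (exp (- (Re \<alpha> * logit t)) / (1 - t) * cmod (odds_power (of_real (- c)) t))"
      using c by (simp add: l_def u_def A_def out)
    finally show ?thesis unfolding e .
  qed
  have "0 \<le> A" by (simp add: A_def)
  then show ?thesis
    unfolding schur_kernel_def using left right borel_measurable_resolvent_kernel
    by (intro conjI exI[of _ A]) simp_all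
qed

text \<open>As a function of \<open>y\<close>, the product of the two kernels is a constant times the power of the odds with
  exponent \<open>\<gamma> = \<beta> - \<alpha>\<close>, divided by \<open>y * (1 - y)\<close> and cut off to an interval:
  between \<open>x\<close> and \<open>t\<close> (possibly empty) if both kernels live on the same side, and below \<open>min x t\<close> or above \<open>max x t\<close> if they live on opposite sides. In the
  latter cases the sign of \<open>Re \<gamma>\<close> makes the power vanish at the end of the unit interval. Evaluating
  the primitive at \<open>x\<close> produces the kernel for \<open>\<beta>\<close>, and at \<open>t\<close> the kernel for \<open>\<alpha>\<close>.\<close>

lemma resolvent_kernel_compose:
  assumes ab: "\<alpha> \<noteq> \<beta>" "Re \<alpha> \<noteq> 1 / 2" "Re \<beta> \<noteq> 1 / 2"
    and xt: "0 < x" "x < 1" "0 < t" "t < 1" "x \<noteq> t"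
  shows "(\<integral>y. resolvent_kernel \<alpha> x y * resolvent_kernel \<beta> y t \<partial>unit_ivl)
    = (resolvent_kernel \<alpha> x t - resolvent_kernel \<beta> x t) / (\<alpha> - \<beta>)"
proof -
  define \<gamma> where "\<gamma> = \<beta> - \<alpha>"
  define C where "C = exp (\<alpha> * of_real (logit x)) * exp (- (\<beta> * of_real (logit t))) / of_real (x * (1 - t))"
  have \<gamma>: "\<gamma> \<noteq> 0"
    using ab by (simp add: \<gamma>_def)
  have prod: "resolvent_kernel \<alpha> x y * resolvent_kernel \<beta> y t
      = side_sign \<alpha> x y * side_sign \<beta> y t * (C * (odds_power \<gamma> y / of_real (y * (1 - y))))"
    if y: "0 < y" "y < 1" for y
  proof -
    have "exp (\<alpha> * of_real (logit x - logit y)) * exp (\<beta> * of_real (logit y - logit t))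
        = exp (\<alpha> * of_real (logit x)) * exp (- (\<beta> * of_real (logit t))) * odds_power \<gamma> y"
      unfolding odds_power_eq[OF y] exp_add[symmetric] \<gamma>_def by (simp add: algebra_simps)
    then show ?thesis
      by (simp add: resolvent_kernel_def C_def mult_ac)
  qed
  have integral_value: "(\<integral>y. resolvent_kernel \<alpha> x y * resolvent_kernel \<beta> y t \<partial>unit_ivl)
      = s * (C * ((odds_power \<gamma> u - odds_power \<gamma> l) / \<gamma>))"
    if lu: "0 \<le> l" "l < u" "u \<le> 1" "l = 0 \<Longrightarrow> 0 < Re \<gamma>" "u = 1 \<Longrightarrow> Re \<gamma> < 0"
      and s: "\<And>y. 0 < y \<Longrightarrow> y < 1 \<Longrightarrow> side_sign \<alpha> x y * side_sign \<beta> y t = (if l < y \<and> y < u then s else 0)" for l u s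
  proof -
    have [measurable]: "(\<lambda>y. resolvent_kernel \<alpha> x y * resolvent_kernel \<beta> y t) \<in> borel_measurable borel"
      unfolding resolvent_kernel_def side_sign_def by measurable
    have "(\<integral>y. resolvent_kernel \<alpha> x y * resolvent_kernel \<beta> y t \<partial>unit_ivl)
        = (\<integral>y. s * C * (indicator {l<..<u} y *\<^sub>R (odds_power \<gamma> y / of_real (y * (1 - y)))) \<partial>lborel)"
    proof (subst unit_ivl_integral_lborel, simp, intro Bochner_Integration.integral_cong refl)
      fix y
      show "indicator {0<..<1} y *\<^sub>R (resolvent_kernel \<alpha> x y * resolvent_kernel \<beta> y t)
          = s * C * (indicator {l<..<u} y *\<^sub>R (odds_power \<gamma> y / of_real (y * (1 - y))))"
      proof (cases "0 < y \<and> y < 1")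
        case True
        then show ?thesis by (simp add: prod s indicator_def)
      next
        case False
        then show ?thesis using lu by (auto simp: indicator_def)
      qed
    qed
    also have "\<dots> = s * C * (LBINT y:{l<..<u}. odds_power \<gamma> y / of_real (y * (1 - y)))"
      unfolding set_lebesgue_integral_def by (rule integral_mult_right_zero)
    finally show ?thesis
      using integral_odds_power[OF lu(1-3) \<gamma> lu(4,5)] by simp
  qed
  have out: "odds_power \<gamma> 0 = 0" "odds_power \<gamma> 1 = 0"
    by (simp_all add: odds_power_def)
  have Cx: "C * odds_power \<gamma> x = exp (\<beta> * of_real (logit x - logit t)) / of_real (x * (1 - t))"
    and Ct: "C * odds_power \<gamma> t = exp (\<alpha> * of_real (logit x - logit t)) / of_real (x * (1 - t))"
    unfolding C_def odds_power_eq[OF xt(1,2)] odds_power_eq[OF xt(3,4)] times_divide_eq_left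
      exp_add[symmetric] \<gamma>_def by (simp_all add: algebra_simps)
  have "resolvent_kernel \<alpha> x t - resolvent_kernel \<beta> x t
      = - (side_sign \<beta> x t * (C * odds_power \<gamma> x) - side_sign \<alpha> x t * (C * odds_power \<gamma> t))"
    unfolding resolvent_kernel_def Cx Ct by simp
  moreover have "\<alpha> - \<beta> = - \<gamma>"
    by (simp add: \<gamma>_def)
  ultimately have rhs: "(resolvent_kernel \<alpha> x t - resolvent_kernel \<beta> x t) / (\<alpha> - \<beta>)
      = (side_sign \<beta> x t * (C * odds_power \<gamma> x) - side_sign \<alpha> x t * (C * odds_power \<gamma> t)) / \<gamma>"
    by (simp only: minus_divide_divide)
  consider "Re \<alpha> < 1 / 2" "Re \<beta> < 1 / 2" | "Re \<alpha> < 1 / 2" "Re \<beta> > 1 / 2"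
    | "Re \<alpha> > 1 / 2" "Re \<beta> < 1 / 2" | "Re \<alpha> > 1 / 2" "Re \<beta> > 1 / 2"
    using ab by linarith
  then show ?thesis
  proof cases
    case 1
    show ?thesis
    proof (cases "t < x")
      case True
      then show ?thesis
        unfolding rhs using 1 xt
        by (subst integral_value[of t x 1]) (auto simp: side_sign_def algebra_simps)
    next
      case False
      have zero: "resolvent_kernel \<alpha> x y * resolvent_kernel \<beta> y t = 0" for y
        using 1 xt False by (auto simp: resolvent_kernel_def side_sign_def)
      show ?thesis
        unfolding rhs zero using 1 xt False by (simp add: side_sign_def)
    qed
  next
    case 2
    then have "Re \<gamma> > 0" by (simp add: \<gamma>_def)
    then show ?thesis
      unfolding rhs using 2 xt
      by (subst integral_value[of 0 "min x t" "-1"]) (auto simp: side_sign_def min_def out split: if_splits)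
  next
    case 3
    then have "Re \<gamma> < 0" by (simp add: \<gamma>_def)
    then show ?thesis
      unfolding rhs using 3 xt
      by (subst integral_value[of "max x t" 1 "-1"]) (auto simp: side_sign_def max_def out split: if_splits)
  next
    case 4
    show ?thesis
    proof (cases "x < t")
      case True
      then show ?thesis
        unfolding rhs using 4 xt
        by (subst integral_value[of x t 1]) (auto simp: side_sign_def algebra_simps)
    next
      case False
      have zero: "resolvent_kernel \<alpha> x y * resolvent_kernel \<beta> y t = 0" for y
        using 4 xt False by (auto simp: resolvent_kernel_def side_sign_def)
      show ?thesis
        unfolding rhs zero using 4 xt False by (simp add: side_sign_def)
    qed
  qed
qed

section \<open>The resolvent of the Cesaro operator\<close>

text \<open>For \<open>\<alpha> = 0\<close> the power of the odds disappears from the kernel.\<close>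

lemma cesaro_eq_integral_op: "cesaro F = integral_op (resolvent_kernel 0) F"
proof (rule L2_cases[of F])
  fix f assume f: "F = abs_L2 f" "square_integrable f"
  have k: "schur_kernel (resolvent_kernel 0)"
    by (rule schur_kernel_resolvent_kernel) simp
  have "cesaro_fun f x = kernel_fun (resolvent_kernel 0) f x" if "0 < x" "x < 1" for x
    unfolding cesaro_fun_kernel[OF that] kernel_fun_def
    by (rule Bochner_Integration.integral_cong) (simp_all add: cesaro_kernel_eq_resolvent_kernel)
  then have "AE x in unit_ivl. cesaro_fun f x = kernel_fun (resolvent_kernel 0) f x"
    by (intro AE_I2) simp
  then show ?thesis
    using f k by (simp add: cesaro_abs_L2 integral_op_abs_L2 abs_L2_eq_iff
        square_integrable_cesaro_fun square_integrable_kernel_fun)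
qed

text \<open>The form of the first resolvent identity that suits the normalisation \<open>\<alpha> = 1 / \<lambda>\<close>: these operators
  are \<open>C (1 - \<alpha> C)\<^sup>-\<^sup>1\<close>.\<close>

lemma resolvent_identity:
  assumes ab: "\<alpha> \<noteq> \<beta>" "Re \<alpha> \<noteq> 1 / 2" "Re \<beta> \<noteq> 1 / 2"
  shows "(\<alpha> - \<beta>) *\<^sub>C integral_op (resolvent_kernel \<alpha>) (integral_op (resolvent_kernel \<beta>) F)
    = integral_op (resolvent_kernel \<alpha>) F - integral_op (resolvent_kernel \<beta>) F"
proof (rule L2_cases[of F])
  fix f assume f: "F = abs_L2 f" "square_integrable f"
  let ?A = "resolvent_kernel \<alpha>" and ?B = "resolvent_kernel \<beta>"
  define D where "D x t = (?A x t - ?B x t) / (\<alpha> - \<beta>)" for x t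
  note k = schur_kernel_resolvent_kernel[OF ab(2)] schur_kernel_resolvent_kernel[OF ab(3)]
  note [measurable] = borel_measurable_resolvent_kernel
  have Dm: "case_prod D \<in> borel_measurable (borel \<Otimes>\<^sub>M borel)"
    unfolding D_def by measurable
  have "AE x in unit_ivl. kernel_fun ?A (kernel_fun ?B f) x = kernel_fun D f x"
    by (rule kernel_fun_compose_AE[OF k f(2) _ Dm])
      (simp add: D_def resolvent_kernel_compose[OF ab])
  then have "AE x in unit_ivl. (\<alpha> - \<beta>) * kernel_fun ?A (kernel_fun ?B f) x + kernel_fun ?B f x
      = kernel_fun ?A f x"
    using kernel_integrable_AE[OF k(1) f(2)] kernel_integrable_AE[OF k(2) f(2)]
  proof eventually_elim
    case (elim x)
    have "kernel_fun D f x = (\<integral>t. (?A x t * f t - ?B x t * f t) / (\<alpha> - \<beta>) \<partial>unit_ivl)"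
      unfolding kernel_fun_def D_def by (simp add: diff_divide_distrib left_diff_distrib)
    also have "\<dots> = (kernel_fun ?A f x - kernel_fun ?B f x) / (\<alpha> - \<beta>)"
      using elim(2,3) by (simp add: kernel_fun_def)
    finally show ?case
      using ab(1) elim(1) by (simp add: field_simps)
  qed
  then have "(\<alpha> - \<beta>) *\<^sub>C integral_op ?A (integral_op ?B F) + integral_op ?B F = integral_op ?A F"
    using f k by (simp add: integral_op_abs_L2 abs_L2_scaleC abs_L2_add abs_L2_eq_iff
        square_integrable_kernel_fun square_integrable_cmult square_integrable_add)
  then show ?thesis
    by (simp add: algebra_simps)
qed

text \<open>Writing \<open>K\<close> for the operator with kernel \<open>resolvent_kernel \<alpha>\<close>, the resolvent identity for the pairs
  \<open>(\<alpha>, 0)\<close> and \<open>(0, \<alpha>)\<close> says \<open>\<alpha> C K = \<alpha> K C = K - C\<close>. Hence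
  \<open>(1 / \<alpha> - C) (\<alpha> + \<alpha>\<^sup>2 K) = 1 + \<alpha> (K - C) - \<alpha>\<^sup>2 C K = 1\<close>, and likewise in the other order.\<close>

lemma is_inverse_resolvent:
  assumes "\<alpha> \<noteq> 0" "Re \<alpha> \<noteq> 1 / 2"
  shows "is_inverse (cscale (1 / \<alpha>) - cesaro)
    (cscale \<alpha> + (cscale (\<alpha>\<^sup>2) o\<^sub>L integral_op (resolvent_kernel \<alpha>)))"
proof -
  interpret L2: vector_space "(*\<^sub>C)"
    by (rule vector_space_L2)
  let ?K = "integral_op (resolvent_kernel \<alpha>)" and ?C = "integral_op (resolvent_kernel 0)"
  have scale [simp]: "cscale c F = c *\<^sub>C F" for c F
    by (rule cscale.rep_eq[THEN fun_cong])
  have K: "?K (c *\<^sub>C F) = c *\<^sub>C ?K F" and C: "?C (c *\<^sub>C F) = c *\<^sub>C ?C F" for c F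
    using assms by (auto intro!: integral_op_scaleC schur_kernel_resolvent_kernel)
  have CK: "\<alpha> *\<^sub>C ?C (?K F) = ?K F - ?C F" for F
    using resolvent_identity[of 0 \<alpha> F] assms by (simp add: L2.scale_minus_left) (metis minus_diff_eq minus_minus)
  have KC: "\<alpha> *\<^sub>C ?K (?C F) = ?K F - ?C F" for F
    using resolvent_identity[of \<alpha> 0 F] assms by simp
  have CK2: "(\<alpha>\<^sup>2) *\<^sub>C ?C (?K F) = \<alpha> *\<^sub>C (?K F - ?C F)"
    and KC2: "(\<alpha>\<^sup>2) *\<^sub>C ?K (?C F) = \<alpha> *\<^sub>C (?K F - ?C F)" for F
    using CK[of F] KC[of F] by (simp_all add: power2_eq_square flip: L2.scale_scale)
  show ?thesis
    unfolding is_inverse_def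
  proof (intro conjI blinfun_eqI)
    fix F
    show "((cscale \<alpha> + (cscale (\<alpha>\<^sup>2) o\<^sub>L ?K)) o\<^sub>L (cscale (1 / \<alpha>) - cesaro)) F = id_blinfun F"
      using assms by (simp add: blinfun.add_left blinfun.diff_left blinfun.diff_right cesaro_eq_integral_op
          K L2.scale_right_diff_distrib KC2)
        (simp add: power2_eq_square)
    show "((cscale (1 / \<alpha>) - cesaro) o\<^sub>L (cscale \<alpha> + (cscale (\<alpha>\<^sup>2) o\<^sub>L ?K))) F = id_blinfun F"
      using assms by (simp add: blinfun.add_left blinfun.diff_left blinfun.add_right cesaro_eq_integral_op
          C L2.scale_right_distrib L2.scale_right_diff_distrib CK2)
        (simp add: power2_eq_square)
  qed
qed

lemma op_inverse_eq: "is_inverse T R \<Longrightarrow> op_inverse T = R"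
  unfolding op_inverse_def using is_inverse_unique by blast

lemma resolvent_AE:
  assumes a: "\<alpha> \<noteq> 0" "Re \<alpha> \<noteq> 1 / 2" and g: "square_integrable g"
  shows "AE x in unit_ivl. rep_L2 (op_inverse (cscale (1 / \<alpha>) - cesaro) (abs_L2 g)) x
    = \<alpha> * g x + \<alpha>\<^sup>2 * kernel_fun (resolvent_kernel \<alpha>) g x"
proof -
  note k = schur_kernel_resolvent_kernel[OF a(2)]
  note sq = square_integrable_cmult[OF g, of \<alpha>]
    square_integrable_cmult[OF square_integrable_kernel_fun[OF k g], of "\<alpha>\<^sup>2"]
  have "op_inverse (cscale (1 / \<alpha>) - cesaro) (abs_L2 g)
      = abs_L2 (\<lambda>x. \<alpha> * g x + \<alpha>\<^sup>2 * kernel_fun (resolvent_kernel \<alpha>) g x)"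
    unfolding op_inverse_eq[OF is_inverse_resolvent[OF a]]
    using sq by (simp add: blinfun.add_left cscale.rep_eq integral_op_abs_L2 k g abs_L2_scaleC
        square_integrable_kernel_fun abs_L2_add)
  then show ?thesis
    using rep_L2_abs_L2_AE[OF square_integrable_add[OF sq]] by simp
qed

text \<open>Inversion maps the circle of radius 1 about 1, which passes through 0, to the line
  \<open>Re w = 1 / 2\<close>, and the inside of that circle to the half-plane to the right of the line.\<close>

lemma Re_inverse_gt_half_iff:
  assumes "z \<noteq> 0"
  shows "1 / 2 < Re (1 / z) \<longleftrightarrow> cmod (z - 1) < 1"
    and "Re (1 / z) < 1 / 2 \<longleftrightarrow> 1 < cmod (z - 1)"
proof -
  have p: "0 < (Re z)\<^sup>2 + (Im z)\<^sup>2"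
    using assms by (simp add: complex_neq_0)
  have R: "Re (1 / z) = Re z / ((Re z)\<^sup>2 + (Im z)\<^sup>2)"
    by (simp add: Re_divide)
  have n: "(cmod (z - 1))\<^sup>2 = (Re z)\<^sup>2 + (Im z)\<^sup>2 - 2 * Re z + 1"
    unfolding cmod_power2 by (simp add: power2_eq_square algebra_simps)
  have "cmod (z - 1) < 1 \<longleftrightarrow> (cmod (z - 1))\<^sup>2 < 1" "1 < cmod (z - 1) \<longleftrightarrow> 1 < (cmod (z - 1))\<^sup>2"
    using abs_square_less_1[of "cmod (z - 1)"] one_less_power[of "cmod (z - 1)" 2]
      power_le_one[of "cmod (z - 1)" 2] by (auto simp: not_le[symmetric])
  then show "1 / 2 < Re (1 / z) \<longleftrightarrow> cmod (z - 1) < 1"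
    and "Re (1 / z) < 1 / 2 \<longleftrightarrow> 1 < cmod (z - 1)"
    unfolding R n using p by (auto simp: field_simps)
qed

lemma exp_logit_powr:
  fixes \<alpha> :: complex
  assumes "0 < x" "x < 1" "0 < t" "t < 1"
  shows "exp (\<alpha> * of_real (logit x - logit t)) / of_real (x * (1 - t))
    = 1 / (of_real x powr (1 - \<alpha>) * of_real (1 - x) powr \<alpha>)
      * (of_real t powr (- \<alpha>) * of_real (1 - t) powr (- 1 + \<alpha>))"
proof -
  define a b c d where "a = complex_of_real (ln x)" and "b = complex_of_real (ln (1 - x))"
    and "c = complex_of_real (ln t)" and "d = complex_of_real (ln (1 - t))"
  have p: "of_real x powr z = exp (z * a)" "of_real (1 - x) powr z = exp (z * b)"
    "of_real t powr z = exp (z * c)" "of_real (1 - t) powr z = exp (z * d)" for z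
    using assms by (simp_all add: powr_def a_def b_def c_def d_def Ln_of_real del: of_real_diff)
  have q: "complex_of_real (x * (1 - t)) = exp (a + d)"
    unfolding a_def d_def using assms by (simp add: exp_add exp_of_real flip: of_real_add)
  have "exp (\<alpha> * of_real (logit x - logit t)) / of_real (x * (1 - t))
      = exp (\<alpha> * (a - b - (c - d)) - (a + d))"
    unfolding q exp_diff[symmetric] by (simp add: logit_def a_def b_def c_def d_def)
  also have "\<alpha> * (a - b - (c - d)) - (a + d)
      = 0 - ((1 - \<alpha>) * a + \<alpha> * b) + (- \<alpha> * c + (- 1 + \<alpha>) * d)"
    by (simp add: algebra_simps)
  finally show ?thesis
    unfolding p by (simp only: exp_add exp_diff exp_zero)
qed

lemma kernel_fun_resolvent_kernel_powr:
  assumes x: "0 < x" "x < 1"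
  shows "kernel_fun (resolvent_kernel \<alpha>) g x =
    (if Re \<alpha> < 1 / 2 then 1 else - 1)
      * (1 / (of_real x powr (1 - \<alpha>) * of_real (1 - x) powr \<alpha>))
      * (\<integral>t. g t * of_real t powr (- \<alpha>) * of_real (1 - t) powr (- 1 + \<alpha>)
          \<partial>lebesgue_on (if Re \<alpha> < 1 / 2 then {0<..<x} else {x<..<1}))"
    (is "_ = ?s * ?p * (\<integral>t. ?f t \<partial>lebesgue_on ?I)")
proof -
  have "kernel_fun (resolvent_kernel \<alpha>) g x
      = (\<integral>t. indicator {0<..<1} t *\<^sub>R (resolvent_kernel \<alpha> x t * g t) \<partial>lebesgue)"
    by (simp add: kernel_fun_def integral_restrict_space)
  also have "\<dots> = (\<integral>t. ?s * ?p * (indicator ?I t *\<^sub>R ?f t) \<partial>lebesgue)"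
  proof (intro Bochner_Integration.integral_cong refl)
    fix t
    show "indicator {0<..<1} t *\<^sub>R (resolvent_kernel \<alpha> x t * g t) = ?s * ?p * (indicator ?I t *\<^sub>R ?f t)"
    proof (cases "0 < t \<and> t < 1")
      case True
      then show ?thesis
        using x by (simp add: resolvent_kernel_def side_sign_def exp_logit_powr indicator_def mult_ac
            del: of_real_diff of_real_mult)
    next
      case False
      then show ?thesis using x by (auto simp: indicator_def)
    qed
  qed
  also have "\<dots> = ?s * ?p * (\<integral>t. indicator ?I t *\<^sub>R ?f t \<partial>lebesgue)"
    by (rule integral_mult_right_zero)
  also have "(\<integral>t. indicator ?I t *\<^sub>R ?f t \<partial>lebesgue) = (\<integral>t. ?f t \<partial>lebesgue_on ?I)"
    by (simp add: integral_restrict_space)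
  finally show ?thesis .
qed

theorem theorem4p1:
  fixes lam :: complex and g :: "real \<Rightarrow> complex"
  assumes "lam \<notin> sphere 1 1"
    and "square_integrable g"
  shows "lam \<notin> spectrum cesaro \<and>
    (lam \<in> ball 1 1 \<longrightarrow>
      (AE x in lebesgue_on {0<..<1}.
        rep_L2 (op_inverse (cscale lam - cesaro) (abs_L2 g)) x =
          1 / lam * g x
          - 1 / lam\<^sup>2 * (1 / (of_real x powr (1 - 1 / lam) * of_real (1 - x) powr (1 / lam)))
            * (\<integral>t. g t * of_real t powr (- 1 / lam) * of_real (1 - t) powr (- 1 + 1 / lam)
                \<partial>lebesgue_on {x<..<1}))) \<and>
    (lam \<notin> cball 1 1 \<longrightarrow>
      (AE x in lebesgue_on {0<..<1}.
        rep_L2 (op_inverse (cscale lam - cesaro) (abs_L2 g)) x =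
          1 / lam * g x
          + 1 / lam\<^sup>2 * (1 / (of_real x powr (1 - 1 / lam) * of_real (1 - x) powr (1 / lam)))
            * (\<integral>t. g t * of_real t powr (- 1 / lam) * of_real (1 - t) powr (- 1 + 1 / lam)
                \<partial>lebesgue_on {0<..<x})))"
proof -
  define \<alpha> where "\<alpha> = 1 / lam"
  have lam: "lam \<noteq> 0" "cmod (lam - 1) \<noteq> 1"
    using assms(1) by (auto simp: dist_norm norm_minus_commute)
  have lam_eq: "lam = 1 / \<alpha>" and \<alpha>: "\<alpha> \<noteq> 0" "Re \<alpha> \<noteq> 1 / 2"
    using lam Re_inverse_gt_half_iff[OF lam(1)] by (auto simp: \<alpha>_def)
  have pow: "1 / lam\<^sup>2 = \<alpha>\<^sup>2" "- 1 / lam = - \<alpha>" "1 / lam = \<alpha>"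
    by (simp_all add: \<alpha>_def power_divide)
  have "AE x in unit_ivl. rep_L2 (op_inverse (cscale lam - cesaro) (abs_L2 g)) x
      = \<alpha> * g x + \<alpha>\<^sup>2 * kernel_fun (resolvent_kernel \<alpha>) g x"
    unfolding lam_eq by (rule resolvent_AE[OF \<alpha> assms(2)])
  moreover have "AE x in unit_ivl. 0 < x \<and> x < 1"
    by (intro AE_I2) simp
  ultimately have *: "AE x in unit_ivl. rep_L2 (op_inverse (cscale lam - cesaro) (abs_L2 g)) x
      = \<alpha> * g x + \<alpha>\<^sup>2 * ((if Re \<alpha> < 1 / 2 then 1 else - 1)
          * (1 / (of_real x powr (1 - \<alpha>) * of_real (1 - x) powr \<alpha>))
          * (\<integral>t. g t * of_real t powr (- \<alpha>) * of_real (1 - t) powr (- 1 + \<alpha>)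
              \<partial>lebesgue_on (if Re \<alpha> < 1 / 2 then {0<..<x} else {x<..<1})))"
    by eventually_elim (simp only: kernel_fun_resolvent_kernel_powr)
  show ?thesis
  proof (intro conjI impI)
    show "lam \<notin> spectrum cesaro"
      using is_inverse_resolvent[OF \<alpha>] by (auto simp: spectrum_def lam_eq)
  next
    assume "lam \<in> ball 1 1"
    then have "1 / 2 < Re \<alpha>"
      using Re_inverse_gt_half_iff(1)[OF lam(1)] by (simp add: \<alpha>_def dist_norm norm_minus_commute)
    then have side_sign: "(Re \<alpha> < 1 / 2) = False"
      by simp
    show "AE x in lebesgue_on {0<..<1}.
        rep_L2 (op_inverse (cscale lam - cesaro) (abs_L2 g)) x =
          1 / lam * g x
          - 1 / lam\<^sup>2 * (1 / (of_real x powr (1 - 1 / lam) * of_real (1 - x) powr (1 / lam)))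
            * (\<integral>t. g t * of_real t powr (- 1 / lam) * of_real (1 - t) powr (- 1 + 1 / lam)
                \<partial>lebesgue_on {x<..<1})"
      using * unfolding side_sign if_False pow by eventually_elim (simp add: mult.assoc)
  next
    assume "lam \<notin> cball 1 1"
    then have "Re \<alpha> < 1 / 2"
      using Re_inverse_gt_half_iff(2)[OF lam(1)] by (simp add: \<alpha>_def dist_norm norm_minus_commute)
    then have side_sign: "(Re \<alpha> < 1 / 2) = True"
      by simp
    show "AE x in lebesgue_on {0<..<1}.
        rep_L2 (op_inverse (cscale lam - cesaro) (abs_L2 g)) x =
          1 / lam * g x
          + 1 / lam\<^sup>2 * (1 / (of_real x powr (1 - 1 / lam) * of_real (1 - x) powr (1 / lam)))
            * (\<integral>t. g t * of_real t powr (- 1 / lam) * of_real (1 - t) powr (- 1 + 1 / lam)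
                \<partial>lebesgue_on {0<..<x})"
      using * unfolding side_sign if_True pow by eventually_elim (simp add: mult.assoc)
  qed
qed

end
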